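(* Let $K$ be a Legendrian knot in $\mathcal{H}$. Then \begin{equation} E(K)=E(T(K)) \end{equation} for any $T\in\mathrm{PU}(2,1)$ satisfying $T(K)\subset\mathcal{H}$.
   Context: $\mathcal{H}=\mathbb{C}\times\mathbb{R}$ is the 3-dimensional Heisenberg group with coordinates $(z,u)=(x,y,u)$, group law $(z,u)\cdot(z',u')=(z+z',u+u'-\tfrac{1}{2}\Im(z\overline{z'}))$, horizontal distribution spanned by $X=\partial_x-\tfrac12 y\,\partial_u$, $Y=\partial_y+\tfrac12 x\,\partial_u$ (orthonormal, norm $|\cdot|$). The Korányi distance is $d_{\mathcal{H}}(p,q)=\|p^{-1}q\|_{\mathcal{H}}$ with $\|(x,y,u)\|_{\mathcal{H}}=\sqrt[4]{(x^2+y^2)^2+16u^2}$. For a smooth Legendrian knot $K$ (closed embedded curve with horizontal velocity, arc-length measure $dp$), the beta function $B_K(\zeta)=\iint_{K\times K}d_{\mathcal{H}}(p,q)^\zeta\,dp\,dq$, defined for $\Re\zeta>-1$, extends meromorphically to $\mathbb{C}$ with at most simple poles at $-1,-3,-5,\dots$, and the energy is $E(K)=B_K(-2)$. $\mathrm{PU}(2,1)$ is the group of CR automorphisms of the one-point compactification $\mathcal{H}\cup\{\infty\}\cong S^3$ (Möbius transformations); it is generated by the dilations $(x,y,u)\mapsto(\lambda x,\lambda y,\lambda^2u)$, left translations, rotations $(z,u)\mapsto(e^{i\theta}z,u)$, and the inversion $\iota(z,u)=\bigl(z/(|z|^2+4iu),\,-u/(|z|^4+16u^2)\bigr)$. *)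

theory Defs
  imports "HOL-Analysis.Analysis"
begin

type_synonym heis = "complex \<times> real"

definition heis_mult :: "heis \<Rightarrow> heis \<Rightarrow> heis" where
  "heis_mult p q = (fst p + fst q, snd p + snd q - 1/2 * Im (fst p * cnj (fst q)))"

definition heis_inv :: "heis \<Rightarrow> heis" where
  "heis_inv p = (- fst p, - snd p)"

definition koranyi_norm :: "heis \<Rightarrow> real" where
  "koranyi_norm p = root 4 ((cmod (fst p))^4 + 16 * (snd p)^2)"

definition koranyi_dist :: "heis \<Rightarrow> heis \<Rightarrow> real" where
  "koranyi_dist p q = koranyi_norm (heis_mult (heis_inv p) q)"

definition smooth_curve :: "(real \<Rightarrow> heis) \<Rightarrow> bool" where
  "smooth_curve \<gamma> \<longleftrightarrow> (\<exists>D :: nat \<Rightarrow> real \<Rightarrow> heis. D 0 = \<gamma> \<and>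
     (\<forall>n t. (D n has_vector_derivative D (Suc n) t) (at t)))"

text \<open>A Legendrian knot, given by an L-periodic smooth parametrisation that is injective on
  one period, with nonzero horizontal velocity. The velocity (z',u') is horizontal iff
  u' = 1/2 Im(conj z * z'), and then its horizontal norm is |z'|.\<close>
definition legendrian_knot :: "(real \<Rightarrow> heis) \<Rightarrow> real \<Rightarrow> bool" where
  "legendrian_knot \<gamma> L \<longleftrightarrow> L > 0 \<and> smooth_curve \<gamma> \<and> (\<forall>t. \<gamma> (t + L) = \<gamma> t) \<and>
     inj_on \<gamma> {0..<L} \<and>
     (\<forall>t. fst (vector_derivative \<gamma> (at t)) \<noteq> 0 \<and>
          snd (vector_derivative \<gamma> (at t)) =
            1/2 * Im (cnj (fst (\<gamma> t)) * fst (vector_derivative \<gamma> (at t))))"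

definition hspeed :: "(real \<Rightarrow> heis) \<Rightarrow> real \<Rightarrow> real" where
  "hspeed \<gamma> t = cmod (fst (vector_derivative \<gamma> (at t)))"

text \<open>Beta function B_K(zeta) (as a Lebesgue integral, meaningful for Re zeta > -1).\<close>
definition beta_fun :: "(real \<Rightarrow> heis) \<Rightarrow> real \<Rightarrow> complex \<Rightarrow> complex" where
  "beta_fun \<gamma> L \<zeta> = (LINT st : {0..L} \<times> {0..L} | lborel.
      (complex_of_real (koranyi_dist (\<gamma> (fst st)) (\<gamma> (snd st))) powr \<zeta>) *
      complex_of_real (hspeed \<gamma> (fst st) * hspeed \<gamma> (snd st)))"

definition odd_neg_ints :: "complex set" where
  "odd_neg_ints = {- of_nat (2 * k + 1) | k :: nat. True}"

text \<open>Energy: value at -2 of the meromorphic continuation of the beta function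
  (holomorphic away from the possible poles -1,-3,-5,...).\<close>
definition energy :: "(real \<Rightarrow> heis) \<Rightarrow> real \<Rightarrow> complex" where
  "energy \<gamma> L = (THE e. \<exists>f. f holomorphic_on (- odd_neg_ints) \<and>
      (\<forall>\<zeta>. Re \<zeta> > -1 \<longrightarrow> f \<zeta> = beta_fun \<gamma> L \<zeta>) \<and> e = f (-2))"

section \<open>PU(2,1) acting on H \<union> {\<infinity>} (None = \<infinity>)\<close>

definition heis_dilation :: "real \<Rightarrow> heis option \<Rightarrow> heis option" where
  "heis_dilation l = map_option (\<lambda>(z, u). (of_real l * z, l^2 * u))"

definition heis_translation :: "heis \<Rightarrow> heis option \<Rightarrow> heis option" where
  "heis_translation p = map_option (heis_mult p)"

definition heis_rotation :: "real \<Rightarrow> heis option \<Rightarrow> heis option" where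
  "heis_rotation \<theta> = map_option (\<lambda>(z, u). (cis \<theta> * z, u))"

definition heis_inversion :: "heis option \<Rightarrow> heis option" where
  "heis_inversion P = (case P of
      None \<Rightarrow> Some (0, 0)
    | Some (z, u) \<Rightarrow> (if z = 0 \<and> u = 0 then None
        else Some (z / (of_real ((cmod z)^2) + 4 * \<i> * of_real u),
                   - u / ((cmod z)^4 + 16 * u^2))))"

inductive_set PU21 :: "(heis option \<Rightarrow> heis option) set" where
  PU21_id: "id \<in> PU21"
| PU21_dil: "l > 0 \<Longrightarrow> T \<in> PU21 \<Longrightarrow> heis_dilation l \<circ> T \<in> PU21"
| PU21_trans: "T \<in> PU21 \<Longrightarrow> heis_translation p \<circ> T \<in> PU21"
| PU21_rot: "T \<in> PU21 \<Longrightarrow> heis_rotation \<theta> \<circ> T \<in> PU21"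
| PU21_inv: "T \<in> PU21 \<Longrightarrow> heis_inversion \<circ> T \<in> PU21"

text \<open>Image curve T(K), meaningful when T(K) avoids infinity.\<close>
definition image_curve :: "(heis option \<Rightarrow> heis option) \<Rightarrow> (real \<Rightarrow> heis) \<Rightarrow> real \<Rightarrow> heis" where
  "image_curve T \<gamma> t = the (T (Some (\<gamma> t)))"

end

theory Submission
  imports Defs "HOL-Complex_Analysis.Complex_Analysis"
begin

text \<open>Near the diagonal the Koranyi distance along a Legendrian curve is \<open>|t - s|\<close> times a smooth
  positive function, so after symmetrisation \<open>B(\<zeta>) = \<integral>\<integral> r\<^sup>\<zeta> H(\<zeta>, s, r) dr ds\<close> with \<open>H\<close> smooth and
  even in \<open>r\<close> and entire in \<open>\<zeta>\<close>. Since \<open>\<partial>H/\<partial>r = r H\<^sub>1\<close> with \<open>H\<^sub>1\<close> again smooth and even, repeated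
  integration by parts continues \<open>B\<close> across the poles -1, -3, ..., and shows that the value
  of the continuation at -2 depends only on \<open>H(-2, s, r)\<close>, that is, on the density
  \<open>d(p, q)\<^sup>-\<^sup>2 dp dq\<close>. This density is invariant: an element of PU(2,1) lifts to a linear map preserving
  a Hermitian form whose modulus on normalised null vectors is the squared Koranyi distance, and
  the normalising factors cancel against the change of arc length.\<close>

section \<open>Kernels depending smoothly on a real variable and holomorphically on a parameter\<close>

text \<open>Passing from K to T(K) multiplies the density d^\<zeta> dp dq by |\<alpha>(s)
  \<alpha>(t)| to the power -1 - \<zeta>/2, for some nowhere vanishing function \<alpha> on the
  curve. The exponent is zero only at \<zeta> = -2, outside the half-plane where the beta function
  is an integral, so the energies cannot be compared as integrals. Instead the difference of the two
  kernels, taken in the same parametrisation, is continued as a whole: it vanishes at \<zeta> = -2,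
  and integration by parts turns a kernel vanishing at one \<zeta> into a boundary term and a new
  kernel that both vanish there. Evenness is what makes -2 a regular point: a term linear in r in
  the expansion of the kernel at the diagonal would produce a pole at -2, and folding r < 0 onto r >
  0 cancels it. The points \<gamma>(s) and \<gamma>(s + r) with r \<noteq> 0 stay apart for |r| < L
  and meet again at |r| = L. Kernels are therefore smooth for |r| < L, and periodicity lets the
  integral run over |r| \<le> L/2 only.\<close>

text \<open>Differentiation under the integral sign asks for a jointly continuous z-derivative,
  while continuity is assumed for \<open>f\<close> only. Cauchy's formula writes the derivative as a
  circle integral of \<open>f\<close>, and joint continuity is inherited from there.\<close>

lemma holomorphic_on_integral:
  fixes f :: "complex \<Rightarrow> 'b::euclidean_space \<Rightarrow> complex"
  assumes "open U"
    and cont: "continuous_on (U \<times> cbox a b) (\<lambda>(z, t). f z t)"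
    and hol: "\<And>t. t \<in> cbox a b \<Longrightarrow> (\<lambda>z. f z t) holomorphic_on U"
  shows "(\<lambda>z. integral (cbox a b) (f z)) holomorphic_on U"
proof -
  have "\<exists>e>0. (\<lambda>z. integral (cbox a b) (f z)) holomorphic_on ball z0 e" if "z0 \<in> U" for z0
  proof -
    obtain e where e: "e > 0" "cball z0 e \<subseteq> U"
      using open_contains_cball_eq[OF \<open>open U\<close>, THEN spec, of z0] \<open>z0 \<in> U\<close> by auto
    define fx where "fx z t = 1 / (2 * of_real pi * \<i>) *
        integral (cbox 0 1) (\<lambda>x. f (circlepath z0 e x) t / (circlepath z0 e x - z)^2 *
          (2 * pi * \<i> * e * exp (2 * of_real pi * \<i> * x)))" for z t
    \<comment> \<open>Half the radius keeps z off the circle of radius \<open>e\<close>, so the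
      denominator in \<open>fx\<close> never vanishes.\<close>
    have "ball z0 (e/2) \<subseteq> cball z0 e" using e(1) by auto
    with e(2) have sub: "ball z0 (e/2) \<subseteq> U" by blast
    have der: "((\<lambda>z. f z t) has_field_derivative fx z t) (at z)"
      if "z \<in> ball z0 (e/2)" "t \<in> cbox a b" for z t
    proof -
      have z: "z \<in> ball z0 e" using that(1) e(1) subset_ball[of "e/2" e z0] by auto
      have "(\<lambda>z. f z t) holomorphic_on cball z0 e"
        by (rule holomorphic_on_subset[OF hol[OF that(2)] e(2)])
      then have "((\<lambda>z. f z t) has_field_derivative (1 / (2 * of_real pi * \<i>) *
          contour_integral (circlepath z0 e) (\<lambda>u. f u t / (u - z)^2))) (at z)"
        by (intro Cauchy_derivative_integral_circlepath(2)[OF _ _ z] holomorphic_on_imp_continuous_on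
            holomorphic_on_subset[OF _ ball_subset_cball])
      then show ?thesis
        unfolding fx_def contour_integral_integral
        by (simp add: vector_derivative_circlepath)
    qed
    have img: "circlepath z0 e x \<in> cball z0 e" "dist z0 (circlepath z0 e x) = e" for x
      using e(1) by (auto simp: circlepath dist_norm norm_mult)
    have cfx: "continuous_on (ball z0 (e/2) \<times> cbox a b) (\<lambda>(z, t). fx z t)"
    proof -
      have ne: "circlepath z0 e x \<noteq> z" if "z \<in> ball z0 (e/2)" for x z
      proof
        assume "circlepath z0 e x = z"
        then have "dist z0 z = e" using img(2)[of x] by simp
        then show False using that e(1) by auto
      qed
      have ccp: "continuous_on A (\<lambda>p. circlepath z0 e (g p))" if "continuous_on A g" for g and A :: "((complex \<times> 'b) \<times> real) set"
        unfolding circlepath by (intro continuous_intros that)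
      have c1: "continuous_on ((ball z0 (e/2) \<times> cbox a b) \<times> cbox 0 1)
          (\<lambda>p. f (circlepath z0 e (snd p)) (snd (fst p)))"
      proof -
        have "continuous_on ((ball z0 (e/2) \<times> cbox a b) \<times> cbox 0 1)
            (\<lambda>p. (circlepath z0 e (snd p), snd (fst p)))"
          by (intro continuous_intros ccp)
        moreover have "(\<lambda>p. (circlepath z0 e (snd p), snd (fst p))) `
            ((ball z0 (e/2) \<times> cbox a b) \<times> cbox 0 1) \<subseteq> U \<times> cbox a b"
          using img(1) e(2) by (auto simp del: mem_cball)
        ultimately show ?thesis using continuous_on_compose2[OF cont] by fastforce
      qed
      have "continuous_on ((ball z0 (e/2) \<times> cbox a b) \<times> cbox 0 1)
         (\<lambda>(zt, x). f (circlepath z0 e x) (snd zt) / (circlepath z0 e x - fst zt)^2 *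
          (2 * pi * \<i> * e * exp (2 * of_real pi * \<i> * complex_of_real x)))"
        unfolding split_beta
        by (intro continuous_intros c1 ccp) (use ne in \<open>auto simp: split_beta\<close>)
      from integral_continuous_on_param[OF this]
      show ?thesis unfolding fx_def split_beta by (intro continuous_intros) (auto simp: split_beta)
    qed
    have "(\<lambda>z. integral (cbox a b) (f z)) holomorphic_on ball z0 (e/2)"
    proof (rule leibniz_rule_holomorphic[OF _ _ cfx])
      show "((\<lambda>z. f z t) has_field_derivative fx z t) (at z within ball z0 (e/2))"
        if "z \<in> ball z0 (e/2)" "t \<in> cbox a b" for z t
        using der[OF that] by (rule has_field_derivative_at_within)
      show "f z integrable_on cbox a b" if "z \<in> ball z0 (e/2)" for z
      proof -
        have "continuous_on (cbox a b) (\<lambda>t. (z, t))" by (intro continuous_intros)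
        moreover have "(\<lambda>t. (z, t)) ` cbox a b \<subseteq> U \<times> cbox a b" using that sub by blast
        ultimately have "continuous_on (cbox a b) (f z)"
          using continuous_on_compose2[OF cont] by fastforce
        then show ?thesis by (rule integrable_continuous)
      qed
    qed auto
    then show ?thesis using e(1) by (intro exI[of _ "e/2"]) auto
  qed
  then show ?thesis
    by (intro analytic_imp_holomorphic) (unfold analytic_on_def, blast)
qed

text \<open>The class is generated by closure rules, so that one rule induction shows that it is stable under
  differentiation in \<open>r\<close>, whence its members are smooth for \<open>|r| < b\<close>. Conjugating \<open>\<zeta>\<close> as well in
  the rule \<open>cnj\<close> preserves holomorphy.\<close>

inductive smooth_kernel :: "real \<Rightarrow> (complex \<Rightarrow> real \<Rightarrow> real \<Rightarrow> complex) \<Rightarrow> bool" for b where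
  param: "continuous_on UNIV (\<lambda>(\<zeta>, s). f \<zeta> s) \<Longrightarrow> (\<And>s. (\<lambda>\<zeta>. f \<zeta> s) holomorphic_on UNIV) \<Longrightarrow>
    smooth_kernel b (\<lambda>\<zeta> s r. f \<zeta> s)"
| translate: "(\<And>n t. (D n has_vector_derivative D (Suc n) t) (at t)) \<Longrightarrow>
    smooth_kernel b (\<lambda>\<zeta> s r. D (n::nat) (s + r))"
| add: "smooth_kernel b F \<Longrightarrow> smooth_kernel b G \<Longrightarrow> smooth_kernel b (\<lambda>\<zeta> s r. F \<zeta> s r + G \<zeta> s r)"
| mult: "smooth_kernel b F \<Longrightarrow> smooth_kernel b G \<Longrightarrow> smooth_kernel b (\<lambda>\<zeta> s r. F \<zeta> s r * G \<zeta> s r)"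
| exp: "smooth_kernel b F \<Longrightarrow> smooth_kernel b (\<lambda>\<zeta> s r. exp (F \<zeta> s r))"
| inverse: "smooth_kernel b F \<Longrightarrow> (\<And>\<zeta> s r. \<bar>r\<bar> < b \<Longrightarrow> F \<zeta> s r \<noteq> 0) \<Longrightarrow>
    smooth_kernel b (\<lambda>\<zeta> s r. inverse (F \<zeta> s r))"
| Ln: "smooth_kernel b F \<Longrightarrow> (\<And>\<zeta> s r. \<bar>r\<bar> < b \<Longrightarrow> F \<zeta> s r \<notin> \<real>\<^sub>\<le>\<^sub>0) \<Longrightarrow>
    smooth_kernel b (\<lambda>\<zeta> s r. Ln (F \<zeta> s r))"
| cnj: "smooth_kernel b F \<Longrightarrow> smooth_kernel b (\<lambda>\<zeta> s r. cnj (F (cnj \<zeta>) s r))"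
| reflect: "smooth_kernel b F \<Longrightarrow> smooth_kernel b (\<lambda>\<zeta> s r. F \<zeta> s (- r))"
| average: "smooth_kernel b F \<Longrightarrow>
    smooth_kernel b (\<lambda>\<zeta> s r. integral {0..1} (\<lambda>\<theta>. of_real \<theta> ^ (j::nat) * F \<zeta> s (\<theta> * r)))"

lemma smooth_kernel_const: "smooth_kernel b (\<lambda>\<zeta> s r. c)"
  by (rule smooth_kernel.param) auto

lemma smooth_kernel_zeta: "smooth_kernel b (\<lambda>\<zeta> s r. \<zeta>)"
  by (rule smooth_kernel.param[of "\<lambda>\<zeta> s. \<zeta>"]) (auto simp: split_beta intro!: continuous_intros)

lemma smooth_kernel_uminus: "smooth_kernel b F \<Longrightarrow> smooth_kernel b (\<lambda>\<zeta> s r. - F \<zeta> s r)"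
  using smooth_kernel.mult[OF smooth_kernel_const[of b "-1"]] by simp

lemma smooth_kernel_diff:
  "smooth_kernel b F \<Longrightarrow> smooth_kernel b G \<Longrightarrow> smooth_kernel b (\<lambda>\<zeta> s r. F \<zeta> s r - G \<zeta> s r)"
  using smooth_kernel.add[OF _ smooth_kernel_uminus[of b G]] by simp

lemma scaled_in_interval:
  fixes r \<theta> b :: real
  assumes "- b < r" "r < b" "0 \<le> \<theta>" "\<theta> \<le> 1" shows "\<bar>\<theta> * r\<bar> < b"
proof -
  have "\<bar>\<theta> * r\<bar> \<le> \<bar>r\<bar>" using assms by (auto simp: abs_mult mult_left_le_one_le)
  then show ?thesis using assms by linarith
qed

lemma continuous_on_compose_triple:
  fixes F :: "complex \<Rightarrow> real \<Rightarrow> real \<Rightarrow> complex"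
  assumes F: "continuous_on (UNIV \<times> UNIV \<times> {-b<..<b}) (\<lambda>(\<zeta>, s, r). F \<zeta> s r)"
    and "continuous_on A f" "continuous_on A g" "continuous_on A h"
    and "\<And>x. x \<in> A \<Longrightarrow> \<bar>h x\<bar> < b"
  shows "continuous_on A (\<lambda>x. F (f x) (g x) (h x))"
proof -
  have "continuous_on A (\<lambda>x. (f x, g x, h x))" by (intro continuous_on_Pair assms)
  moreover have "(\<lambda>x. (f x, g x, h x)) ` A \<subseteq> UNIV \<times> UNIV \<times> {-b<..<b}"
    using assms(5) by (auto simp: abs_less_iff minus_less_iff)
  ultimately show ?thesis using continuous_on_compose2[OF F] by fastforce
qed

text \<open>Joint continuity and holomorphy go through one induction because the rule
  \<open>average\<close> needs both at once: they are the hypotheses of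
  \<open>holomorphic_on_integral\<close>.\<close>

lemma smooth_kernel_regular:
  assumes "smooth_kernel b F"
  shows "continuous_on (UNIV \<times> UNIV \<times> {-b<..<b}) (\<lambda>(\<zeta>, s, r). F \<zeta> s r) \<and>
    (\<forall>s. \<forall>r\<in>{-b<..<b}. (\<lambda>\<zeta>. F \<zeta> s r) holomorphic_on UNIV)"
  using assms
proof induction
  case (param f)
  then show ?case
    using continuous_on_compose2[OF param(1), of "UNIV \<times> UNIV \<times> {-b<..<b}" "\<lambda>x. (fst x, fst (snd x))"]
    by (simp add: split_beta continuous_on_fst continuous_on_snd continuous_on_Pair)
next
  case (translate D n)
  have "continuous_on UNIV (D n)"
    using translate by (meson UNIV_I continuous_at_imp_continuous_on has_vector_derivative_continuous)
  then show ?case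
    by (auto simp: split_beta intro!: continuous_intros intro: continuous_on_compose2[where t=UNIV])
next
  case (add F G)
  then show ?case by (auto simp: split_beta intro!: continuous_intros holomorphic_intros)
next
  case (mult F G)
  then show ?case by (auto simp: split_beta intro!: continuous_intros holomorphic_intros)
next
  case (exp F)
  then show ?case by (auto simp: split_beta intro!: continuous_intros holomorphic_intros)
next
  case (inverse F)
  then show ?case by (auto simp: split_beta abs_less_iff intro!: continuous_intros holomorphic_intros)
next
  case (Ln F)
  then show ?case by (auto simp: split_beta abs_less_iff intro!: continuous_intros holomorphic_intros)
next
  case (cnj F)
  have "continuous_on (UNIV \<times> UNIV \<times> {-b<..<b}) (\<lambda>x. F (cnj (fst x)) (fst (snd x)) (snd (snd x)))"
    by (rule continuous_on_compose_triple[OF conjunct1[OF cnj.IH]])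
       (auto intro!: continuous_intros)
  moreover have "(\<lambda>\<zeta>. cnj (F (cnj \<zeta>) s r)) holomorphic_on UNIV" if "r \<in> {-b<..<b}" for s r
    using holomorphic_on_compose_cnj_cnj[of "\<lambda>\<zeta>. F \<zeta> s r" UNIV] holomorphic_on_subset[of _ UNIV "range cnj"]
      cnj.IH that by (auto simp: o_def)
  ultimately show ?case by (auto simp: split_beta intro!: continuous_intros)
next
  case (reflect F)
  have "continuous_on (UNIV \<times> UNIV \<times> {-b<..<b}) (\<lambda>x. F (fst x) (fst (snd x)) (- snd (snd x)))"
    by (rule continuous_on_compose_triple[OF conjunct1[OF reflect.IH]])
       (auto intro!: continuous_intros)
  then show ?case using reflect.IH by (auto simp: split_beta)
next
  case (average F j)
  have c: "continuous_on ((UNIV \<times> UNIV \<times> {-b<..<b}) \<times> cbox 0 1)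
      (\<lambda>(p, \<theta>). of_real \<theta> ^ j * F (fst p) (fst (snd p)) (\<theta> * snd (snd p)))"
    unfolding split_beta
    by (intro continuous_intros continuous_on_compose_triple[OF conjunct1[OF average.IH]])
       (auto intro!: scaled_in_interval)
  have "(\<lambda>\<zeta>. integral (cbox 0 1) (\<lambda>\<theta>. of_real \<theta> ^ j * F \<zeta> s (\<theta> * r))) holomorphic_on UNIV"
    if r: "r \<in> {-b<..<b}" for s r
  proof (rule holomorphic_on_integral)
    show "continuous_on (UNIV \<times> cbox 0 1) (\<lambda>(\<zeta>, \<theta>). of_real \<theta> ^ j * F \<zeta> s (\<theta> * r))"
      unfolding split_beta
      by (intro continuous_intros continuous_on_compose_triple[OF conjunct1[OF average.IH]])
         (use r in \<open>auto intro!: scaled_in_interval\<close>)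
    fix \<theta> :: real assume \<theta>: "\<theta> \<in> cbox 0 1"
    show "(\<lambda>\<zeta>. of_real \<theta> ^ j * F \<zeta> s (\<theta> * r)) holomorphic_on UNIV"
    proof -
      have "\<bar>\<theta> * r\<bar> < b" using r \<theta> by (auto intro!: scaled_in_interval)
      then have "\<theta> * r \<in> {-b<..<b}" by auto
      then show ?thesis using average.IH by (intro holomorphic_intros) blast
    qed
  qed auto
  with integral_continuous_on_param[OF c] show ?case by (simp add: split_beta cbox_interval)
qed

lemma smooth_kernel_continuous:
  assumes "smooth_kernel b F" "continuous_on A f" "continuous_on A g" "continuous_on A h"
    "\<And>x. x \<in> A \<Longrightarrow> \<bar>h x\<bar> < b"
  shows "continuous_on A (\<lambda>x. F (f x) (g x) (h x))"
  using continuous_on_compose_triple[OF conjunct1[OF smooth_kernel_regular]] assms by blast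

lemma smooth_kernel_holomorphic:
  assumes "smooth_kernel b F" "\<bar>r\<bar> < b"
  shows "(\<lambda>\<zeta>. F \<zeta> s r) holomorphic_on UNIV"
  using smooth_kernel_regular[OF assms(1)] assms(2) by (auto simp: abs_less_iff)

lemma smooth_kernel_derivative:
  assumes "smooth_kernel b F"
  obtains F' where "smooth_kernel b F'"
    "\<And>\<zeta> s r. \<bar>r\<bar> < b \<Longrightarrow> ((\<lambda>r. F \<zeta> s r) has_vector_derivative F' \<zeta> s r) (at r)"
proof -
  have "\<exists>F'. smooth_kernel b F' \<and>
    (\<forall>\<zeta> s r. \<bar>r\<bar> < b \<longrightarrow> ((\<lambda>r. F \<zeta> s r) has_vector_derivative F' \<zeta> s r) (at r))"
    using assms
  proof induction
    case (param f)
    show ?case by (intro exI[of _ "\<lambda>\<zeta> s r. 0"]) (auto intro: smooth_kernel_const)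
  next
    case (translate D n)
    have "((\<lambda>r. D n (s + r)) has_vector_derivative D (Suc n) (s + r)) (at r)" for s r
    proof -
      have "((\<lambda>r. s + r) has_vector_derivative 1) (at r)"
        by (auto intro!: derivative_eq_intros)
      from vector_diff_chain_at[OF this translate[of n "s + r"]] show ?thesis by (simp add: o_def)
    qed
    then show ?case
      by (intro exI[of _ "\<lambda>\<zeta> s r. D (Suc n) (s + r)"])
         (auto intro!: smooth_kernel.translate[where D=D and n="Suc n"] translate)
  next
    case (add F G)
    then obtain F' G' where "smooth_kernel b F'" "smooth_kernel b G'"
      "\<forall>\<zeta> s r. \<bar>r\<bar> < b \<longrightarrow> ((\<lambda>r. F \<zeta> s r) has_vector_derivative F' \<zeta> s r) (at r)"
      "\<forall>\<zeta> s r. \<bar>r\<bar> < b \<longrightarrow> ((\<lambda>r. G \<zeta> s r) has_vector_derivative G' \<zeta> s r) (at r)" by blast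
    then show ?case
      by (intro exI[of _ "\<lambda>\<zeta> s r. F' \<zeta> s r + G' \<zeta> s r"])
         (auto intro: smooth_kernel.intros intro!: derivative_intros)
  next
    case (mult F G)
    then obtain F' G' where "smooth_kernel b F'" "smooth_kernel b G'"
      "\<forall>\<zeta> s r. \<bar>r\<bar> < b \<longrightarrow> ((\<lambda>r. F \<zeta> s r) has_vector_derivative F' \<zeta> s r) (at r)"
      "\<forall>\<zeta> s r. \<bar>r\<bar> < b \<longrightarrow> ((\<lambda>r. G \<zeta> s r) has_vector_derivative G' \<zeta> s r) (at r)" by blast
    with mult.hyps show ?case
      by (intro exI[of _ "\<lambda>\<zeta> s r. F \<zeta> s r * G' \<zeta> s r + F' \<zeta> s r * G \<zeta> s r"])
         (auto intro!: smooth_kernel.add smooth_kernel.mult has_vector_derivative_mult)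
  next
    case (exp F)
    then obtain F' where F': "smooth_kernel b F'"
      "\<And>\<zeta> s r. \<bar>r\<bar> < b \<Longrightarrow> ((\<lambda>r. F \<zeta> s r) has_vector_derivative F' \<zeta> s r) (at r)" by blast
    have "((\<lambda>r. exp (F \<zeta> s r)) has_vector_derivative F' \<zeta> s r * exp (F \<zeta> s r)) (at r)" if "\<bar>r\<bar> < b" for \<zeta> s r
      using field_vector_diff_chain_at[OF F'(2)[OF that] DERIV_exp] by (simp add: o_def)
    then show ?case using smooth_kernel.mult[OF F'(1) smooth_kernel.exp[OF exp.hyps]]
      by (intro exI[of _ "\<lambda>\<zeta> s r. F' \<zeta> s r * exp (F \<zeta> s r)"]) simp
  next
    case (inverse F)
    then obtain F' where F': "smooth_kernel b F'"
      "\<And>\<zeta> s r. \<bar>r\<bar> < b \<Longrightarrow> ((\<lambda>r. F \<zeta> s r) has_vector_derivative F' \<zeta> s r) (at r)" by blast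
    have "((\<lambda>r. inverse (F \<zeta> s r)) has_vector_derivative
        F' \<zeta> s r * - (inverse (F \<zeta> s r) * inverse (F \<zeta> s r))) (at r)" if "\<bar>r\<bar> < b" for \<zeta> s r
      using field_vector_diff_chain_at[OF F'(2)[OF that] DERIV_inverse] inverse.hyps(2)[OF that]
      by (simp add: o_def power2_eq_square)
    then show ?case
      using smooth_kernel.inverse[OF inverse.hyps] F'(1)
      by (intro exI[of _ "\<lambda>\<zeta> s r. F' \<zeta> s r * - (inverse (F \<zeta> s r) * inverse (F \<zeta> s r))"] conjI
          smooth_kernel.mult smooth_kernel_uminus) auto
  next
    case (Ln F)
    then obtain F' where F': "smooth_kernel b F'"
      "\<And>\<zeta> s r. \<bar>r\<bar> < b \<Longrightarrow> ((\<lambda>r. F \<zeta> s r) has_vector_derivative F' \<zeta> s r) (at r)" by blast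
    have nz: "F \<zeta> s r \<noteq> 0" if "\<bar>r\<bar> < b" for \<zeta> s r
      using Ln.hyps(2)[OF that, of \<zeta> s] by auto
    have "((\<lambda>r. Ln (F \<zeta> s r)) has_vector_derivative F' \<zeta> s r * inverse (F \<zeta> s r)) (at r)" if "\<bar>r\<bar> < b" for \<zeta> s r
      using field_vector_diff_chain_at[OF F'(2)[OF that] has_field_derivative_Ln] Ln.hyps(2)[OF that]
      by (simp add: o_def)
    then show ?case using smooth_kernel.mult[OF F'(1) smooth_kernel.inverse[OF Ln.hyps(1) nz]]
      by (intro exI[of _ "\<lambda>\<zeta> s r. F' \<zeta> s r * inverse (F \<zeta> s r)"]) simp
  next
    case (cnj F)
    then obtain F' where "smooth_kernel b F'"
      "\<forall>\<zeta> s r. \<bar>r\<bar> < b \<longrightarrow> ((\<lambda>r. F \<zeta> s r) has_vector_derivative F' \<zeta> s r) (at r)" by blast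
    then show ?case
      by (intro exI[of _ "\<lambda>\<zeta> s r. cnj (F' (cnj \<zeta>) s r)"])
         (auto intro: smooth_kernel.cnj intro!: has_vector_derivative_cnj)
  next
    case (reflect F)
    then obtain F' where F': "smooth_kernel b F'"
      "\<forall>\<zeta> s r. \<bar>r\<bar> < b \<longrightarrow> ((\<lambda>r. F \<zeta> s r) has_vector_derivative F' \<zeta> s r) (at r)" by blast
    have "((\<lambda>r. F \<zeta> s (- r)) has_vector_derivative - F' \<zeta> s (- r)) (at r)" if "\<bar>r\<bar> < b" for \<zeta> s r
    proof -
      have "(uminus has_vector_derivative -1) (at r)"
        by (auto intro!: derivative_eq_intros)
      from vector_diff_chain_at[OF this, of "F \<zeta> s" "F' \<zeta> s (-r)"] show ?thesis
        using F'(2) that by (simp add: o_def)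
    qed
    with F' show ?case
      by (intro exI[of _ "\<lambda>\<zeta> s r. - F' \<zeta> s (- r)"])
         (auto intro: smooth_kernel.reflect smooth_kernel_uminus)
  next
    case (average F j)
    then obtain F' where F': "smooth_kernel b F'"
      "\<forall>\<zeta> s r. \<bar>r\<bar> < b \<longrightarrow> ((\<lambda>r. F \<zeta> s r) has_vector_derivative F' \<zeta> s r) (at r)" by blast
    \<comment> \<open>The chain rule for \<theta> * r produces one more factor \<theta>; this is why
      the rule \<open>average\<close> carries the exponent \<open>j\<close>.\<close>
    have "((\<lambda>r. integral (cbox 0 1) (\<lambda>\<theta>. of_real \<theta> ^ j * F \<zeta> s (\<theta> * r))) has_vector_derivative
        integral (cbox 0 1) (\<lambda>\<theta>. of_real \<theta> ^ Suc j * F' \<zeta> s (\<theta> * r))) (at r)" if r: "\<bar>r\<bar> < b" for \<zeta> s r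
    proof -
      have "((\<lambda>r. integral (cbox 0 1) (\<lambda>\<theta>. of_real \<theta> ^ j * F \<zeta> s (\<theta> * r))) has_vector_derivative
        integral (cbox 0 1) (\<lambda>\<theta>. of_real \<theta> ^ Suc j * F' \<zeta> s (\<theta> * r))) (at r within {-b<..<b})"
      proof (rule leibniz_rule_vector_derivative)
        fix r \<theta> :: real assume r: "r \<in> {-b<..<b}" and \<theta>: "\<theta> \<in> cbox 0 1"
        have "\<bar>\<theta> * r\<bar> < b" using r \<theta> by (auto intro!: scaled_in_interval)
        moreover have "((\<lambda>r. \<theta> * r) has_vector_derivative \<theta>) (at r)"
          by (auto intro!: derivative_eq_intros)
        ultimately have "((\<lambda>r. F \<zeta> s (\<theta> * r)) has_vector_derivative \<theta> *\<^sub>R F' \<zeta> s (\<theta> * r)) (at r)"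
          using vector_diff_chain_at[of "\<lambda>r. \<theta> * r" \<theta> r "F \<zeta> s" "F' \<zeta> s (\<theta> * r)"] F'(2)
          by (simp add: o_def)
        then have "((\<lambda>r. of_real \<theta> ^ j * F \<zeta> s (\<theta> * r)) has_vector_derivative
            of_real \<theta> ^ j * (\<theta> *\<^sub>R F' \<zeta> s (\<theta> * r))) (at r)"
          by (rule has_vector_derivative_mult_right)
        then show "((\<lambda>r. of_real \<theta> ^ j * F \<zeta> s (\<theta> * r)) has_vector_derivative
            of_real \<theta> ^ Suc j * F' \<zeta> s (\<theta> * r)) (at r within {-b<..<b})"
          by (simp add: scaleR_conv_of_real ac_simps has_vector_derivative_at_within)
      next
        fix r :: real assume r: "r \<in> {-b<..<b}"
        show "(\<lambda>\<theta>. of_real \<theta> ^ j * F \<zeta> s (\<theta> * r)) integrable_on cbox 0 1"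
          using r
          by (intro integrable_continuous continuous_intros smooth_kernel_continuous[OF average.hyps])
             (auto intro!: scaled_in_interval)
      next
        show "continuous_on ({-b<..<b} \<times> cbox 0 1) (\<lambda>(r, \<theta>). of_real \<theta> ^ Suc j * F' \<zeta> s (\<theta> * r))"
          unfolding split_beta
          by (intro continuous_intros smooth_kernel_continuous[OF F'(1)])
             (auto intro!: scaled_in_interval)
      qed (use r in auto)
      moreover have "at r within {-b<..<b} = at r"
        using r by (intro at_within_open) auto
      ultimately show ?thesis by simp
    qed
    with F' show ?case
      by (intro exI[of _ "\<lambda>\<zeta> s r. integral {0..1} (\<lambda>\<theta>. of_real \<theta> ^ Suc j * F' \<zeta> s (\<theta> * r))"])
         (auto simp: cbox_interval simp del: power_Suc intro: smooth_kernel.average)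
  qed
  then show ?thesis using that by blast
qed

section \<open>Meromorphic continuation of Mellin-type integrals of even kernels\<close>

text \<open>The fundamental theorem of calculus for \<theta> \<mapsto> f(\<theta> r) on [0, 1]. The
  difference quotient becomes an average, hence remains smooth at r = 0, where division by r would
  lose all information.\<close>

lemma hadamard_quotient:
  fixes f f' :: "real \<Rightarrow> complex"
  assumes der: "\<And>x. \<bar>x\<bar> < b \<Longrightarrow> (f has_vector_derivative f' x) (at x)" and r: "\<bar>r\<bar> < b"
  shows "f r - f 0 = of_real r * integral {0..1} (\<lambda>\<theta>. f' (\<theta> * r))"
proof -
  have "((\<lambda>\<theta>. of_real r * f' (\<theta> * r)) has_integral f (1 * r) - f (0 * r)) {0..1}"
  proof (rule fundamental_theorem_of_calculus)
    fix \<theta> :: real assume "\<theta> \<in> {0..1}"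
    then have "\<bar>\<theta> * r\<bar> < b" using r by (intro scaled_in_interval) auto
    moreover have "((\<lambda>\<theta>. \<theta> * r) has_vector_derivative r) (at \<theta>)"
      by (auto intro!: derivative_eq_intros)
    ultimately have "(f \<circ> (\<lambda>\<theta>. \<theta> * r) has_vector_derivative r *\<^sub>R f' (\<theta> * r)) (at \<theta>)"
      by (intro vector_diff_chain_at der)
    then show "((\<lambda>\<theta>. f (\<theta> * r)) has_vector_derivative of_real r * f' (\<theta> * r)) (at \<theta> within {0..1})"
      by (simp add: o_def scaleR_conv_of_real has_vector_derivative_at_within)
  qed simp
  then show ?thesis by (simp add: integral_unique flip: integral_mult_right)
qed

definition even_kernel :: "real \<Rightarrow> (complex \<Rightarrow> real \<Rightarrow> real \<Rightarrow> complex) \<Rightarrow> bool" where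
  "even_kernel b H \<longleftrightarrow> smooth_kernel b H \<and> (\<forall>\<zeta> s r. \<bar>r\<bar> < b \<longrightarrow> H \<zeta> s (- r) = H \<zeta> s r)"

text \<open>The derivative of an even function is odd, so it vanishes at r = 0, and its Hadamard
  quotient by r is a kernel again. A quotient of two odd functions is even, so the construction can
  be iterated.\<close>

lemma even_kernel_derivative:
  assumes "even_kernel b H"
  obtains H1 where "even_kernel b H1"
    "\<And>\<zeta> s r. \<bar>r\<bar> < b \<Longrightarrow> ((\<lambda>r. H \<zeta> s r) has_vector_derivative of_real r * H1 \<zeta> s r) (at r)"
proof -
  from assms have H: "smooth_kernel b H" and ev: "\<And>\<zeta> s r. \<bar>r\<bar> < b \<Longrightarrow> H \<zeta> s (- r) = H \<zeta> s r"
    by (auto simp: even_kernel_def)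
  obtain F where F: "smooth_kernel b F"
    "\<And>\<zeta> s r. \<bar>r\<bar> < b \<Longrightarrow> ((\<lambda>r. H \<zeta> s r) has_vector_derivative F \<zeta> s r) (at r)"
    by (rule smooth_kernel_derivative[OF H]) blast
  obtain G where G: "smooth_kernel b G"
    "\<And>\<zeta> s r. \<bar>r\<bar> < b \<Longrightarrow> ((\<lambda>r. F \<zeta> s r) has_vector_derivative G \<zeta> s r) (at r)"
    by (rule smooth_kernel_derivative[OF F(1)]) blast
  have odd: "F \<zeta> s (- r) = - F \<zeta> s r" if "\<bar>r\<bar> < b" for \<zeta> s r
  proof -
    have "(uminus has_vector_derivative -1) (at r)" by (auto intro!: derivative_eq_intros)
    from vector_diff_chain_at[OF this, of "H \<zeta> s" "F \<zeta> s (-r)"] F(2)[of "-r" \<zeta> s] that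
    have "((\<lambda>r. H \<zeta> s (- r)) has_vector_derivative - F \<zeta> s (- r)) (at r)" by (simp add: o_def)
    then have "((\<lambda>r. H \<zeta> s r) has_vector_derivative - F \<zeta> s (- r)) (at r)"
      by (rule has_vector_derivative_transform_within_open[where S="{-b<..<b}"])
         (use that ev in \<open>auto simp: abs_less_iff\<close>)
    from vector_derivative_unique_at[OF F(2)[OF that] this] show ?thesis by simp
  qed
  define H1 where "H1 = (\<lambda>\<zeta> s r. integral {0..1} (\<lambda>\<theta>. of_real \<theta> ^ 0 * G \<zeta> s (\<theta> * r)))"
  have F_eq: "F \<zeta> s r = of_real r * H1 \<zeta> s r" if "\<bar>r\<bar> < b" for \<zeta> s r
  proof -
    have "F \<zeta> s 0 = 0" using odd[of 0 \<zeta> s] that by simp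
    then show ?thesis using hadamard_quotient[OF G(2) that, of \<zeta> s] by (simp add: H1_def)
  qed
  have "H1 \<zeta> s (- r) = H1 \<zeta> s r" if "\<bar>r\<bar> < b" for \<zeta> s r
    using odd[OF that, of \<zeta> s] F_eq[of r \<zeta> s] F_eq[of "-r" \<zeta> s] that by (cases "r = 0") auto
  moreover have "smooth_kernel b H1" unfolding H1_def by (rule smooth_kernel.average[OF G(1)])
  ultimately have "even_kernel b H1" by (simp add: even_kernel_def)
  with F(2) F_eq that show ?thesis by simp
qed

section \<open>Mellin-type integrals and integration by parts in r\<close>

text \<open>The shift \<open>m\<close> records the powers of r gained by integrating by parts, so
  that all stages of the continuation share one notation.\<close>

definition mellin :: "real \<Rightarrow> real \<Rightarrow> nat \<Rightarrow> (complex \<Rightarrow> real \<Rightarrow> real \<Rightarrow> complex) \<Rightarrow> complex \<Rightarrow> complex" where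
  "mellin L a m H \<zeta> =
    integral {0..L} (\<lambda>s. integral {0..a} (\<lambda>r. of_real r powr (\<zeta> + of_nat m) * H \<zeta> s r))"

lemma continuous_on_of_real_powr:
  fixes g :: "'a::topological_space \<Rightarrow> complex"
  assumes "continuous_on A h" "continuous_on A g" "\<And>x. x \<in> A \<Longrightarrow> 0 \<le> h x" "\<And>x. x \<in> A \<Longrightarrow> 0 < Re (g x)"
  shows "continuous_on A (\<lambda>x. of_real (h x) powr g x)"
  by (rule continuous_on_powr_complex) (use assms in \<open>auto intro!: continuous_intros\<close>)

lemma mellin_integrand_continuous:
  assumes "smooth_kernel b H" "a < b"
    "continuous_on A f" "continuous_on A g" "continuous_on A h"
    "\<And>x. x \<in> A \<Longrightarrow> 0 < Re (f x + of_nat m)" "\<And>x. x \<in> A \<Longrightarrow> 0 \<le> h x" "\<And>x. x \<in> A \<Longrightarrow> h x \<le> a"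
  shows "continuous_on A (\<lambda>x. of_real (h x) powr (f x + of_nat m) * H (f x) (g x) (h x))"
proof -
  have "\<bar>h x\<bar> < b" if "x \<in> A" for x using assms(2) assms(7,8)[OF that] by linarith
  then show ?thesis
    by (intro continuous_on_mult continuous_on_of_real_powr smooth_kernel_continuous[OF assms(1)]
        continuous_intros assms)
qed

lemma mellin_inner_continuous:
  assumes "smooth_kernel b H" "a < b" "0 < Re (\<zeta> + of_nat m)"
  shows "continuous_on A (\<lambda>s. integral {0..a} (\<lambda>r. of_real r powr (\<zeta> + of_nat m) * H \<zeta> s r))"
proof -
  have "continuous_on (A \<times> cbox 0 a) (\<lambda>(s, r). of_real r powr (\<zeta> + of_nat m) * H \<zeta> s r)"
    unfolding split_beta
    by (rule mellin_integrand_continuous[OF assms(1,2)])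
       (use assms(3) in \<open>auto intro!: continuous_intros\<close>)
  from integral_continuous_on_param[OF this] show ?thesis by (simp add: cbox_interval)
qed

text \<open>On this half-plane the integrand is continuous up to r = 0, so the lemma on parameter
  integrals applies to the closed rectangle. The strip where Re (\<zeta> + m) lies in (-1, 0] is
  left to integration by parts.\<close>

lemma mellin_holomorphic:
  assumes "smooth_kernel b H" "a < b"
  shows "mellin L a m H holomorphic_on {\<zeta>. 0 < Re (\<zeta> + of_nat m)}"
proof -
  define U where "U = {\<zeta>. 0 < Re (\<zeta> + of_nat m)}"
  have opn: "open U"
    unfolding U_def by (intro open_Collect_less continuous_intros)
  have "(\<lambda>\<zeta>. integral (cbox (0, 0) (L, a))
      (\<lambda>(s, r). of_real r powr (\<zeta> + of_nat m) * H \<zeta> s r)) holomorphic_on U"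
  proof (rule holomorphic_on_integral[OF opn])
    show "continuous_on (U \<times> cbox (0, 0) (L, a))
        (\<lambda>(\<zeta>, p). case p of (s, r) \<Rightarrow> of_real r powr (\<zeta> + of_nat m) * H \<zeta> s r)"
      unfolding split_beta
      by (rule mellin_integrand_continuous[OF assms(1,2)])
         (auto simp: U_def intro!: continuous_intros)
  next
    fix p :: "real \<times> real" assume p: "p \<in> cbox (0, 0) (L, a)"
    obtain s r where [simp]: "p = (s, r)" by fastforce
    have "\<bar>r\<bar> < b" using p assms(2) by auto
    then have "(\<lambda>\<zeta>. H \<zeta> s r) holomorphic_on U"
      by (intro holomorphic_on_subset[OF smooth_kernel_holomorphic[OF assms(1)]]) auto
    \<comment> \<open>At r = 0 the power is the constant 0, by the convention for
      \<open>powr\<close> at base 0.\<close>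
    then show "(\<lambda>\<zeta>. case p of (s, r) \<Rightarrow> of_real r powr (\<zeta> + of_nat m) * H \<zeta> s r) holomorphic_on U"
      by (cases "r = 0") (auto intro!: holomorphic_intros)
  qed
  moreover have "integral (cbox (0, 0) (L, a)) (\<lambda>(s, r). of_real r powr (\<zeta> + of_nat m) * H \<zeta> s r)
      = mellin L a m H \<zeta>" if "\<zeta> \<in> U" for \<zeta>
  proof -
    have "continuous_on (cbox (0, 0) (L, a)) (\<lambda>(s, r). of_real r powr (\<zeta> + of_nat m) * H \<zeta> s r)"
      unfolding split_beta
      by (rule mellin_integrand_continuous[OF assms(1,2)])
         (use that in \<open>auto simp: U_def intro!: continuous_intros\<close>)
    from integral_prod_continuous[OF this] show ?thesis
      by (simp add: mellin_def cbox_interval)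
  qed
  ultimately show ?thesis unfolding U_def[symmetric] by (rule holomorphic_transform)
qed

text \<open>With w = \<zeta> + m + 1, integrate r^(w-1) to r^w / w: the boundary term at 0 vanishes
  because Re w > 0, and the factor r in the derivative r H1 of H lifts the exponent from \<zeta> + m
  to \<zeta> + m + 2.\<close>

lemma mellin_inner_by_parts:
  assumes H: "smooth_kernel b H" and H1: "smooth_kernel b H1"
    and der: "\<And>\<zeta> s r. \<bar>r\<bar> < b \<Longrightarrow> ((\<lambda>r. H \<zeta> s r) has_vector_derivative of_real r * H1 \<zeta> s r) (at r)"
    and a: "0 < a" "a < b" and re: "- 1 < Re (\<zeta> + of_nat m)"
  shows "((\<lambda>r. of_real r powr (\<zeta> + of_nat m) * H \<zeta> s r) has_integral
    (of_real a powr (\<zeta> + of_nat m + 1) * H \<zeta> s a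
      - integral {0..a} (\<lambda>r. of_real r powr (\<zeta> + of_nat (m + 2)) * H1 \<zeta> s r))
      / (\<zeta> + of_nat m + 1)) {0..a}"
proof -
  define w where "w = \<zeta> + of_nat m + 1"
  have w: "Re w > 0" "w \<noteq> 0" using re by (auto simp: w_def complex_eq_iff)
  have ab: "\<bar>r\<bar> < b" if "r \<in> {0..a}" for r using that a by auto
  have "continuous_on {0..a} (\<lambda>r. of_real r powr (\<zeta> + of_nat (m + 2)) * H1 \<zeta> s r)"
    by (rule mellin_integrand_continuous[OF H1 a(2)])
       (use re in \<open>auto intro!: continuous_intros\<close>)
  then have i2: "((\<lambda>r. of_real r powr (\<zeta> + of_nat (m + 2)) * H1 \<zeta> s r) has_integral
      integral {0..a} (\<lambda>r. of_real r powr (\<zeta> + of_nat (m + 2)) * H1 \<zeta> s r)) {0..a}"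
    by (intro integrable_integral integrable_continuous_interval)
  \<comment> \<open>For Re w < 1 the integrand may be unbounded at 0. Continuity of r^w H on the
    closed interval and a derivative in its interior suffice for the gauge integral, so
    integrability comes with the value.\<close>
  have total: "((\<lambda>r. of_real r powr (w - 1) * w * H \<zeta> s r + of_real r powr w * (of_real r * H1 \<zeta> s r)) has_integral
      of_real a powr w * H \<zeta> s a - of_real 0 powr w * H \<zeta> s 0) {0..a}"
  proof (rule fundamental_theorem_of_calculus_interior)
    show "continuous_on {0..a} (\<lambda>r. of_real r powr w * H \<zeta> s r)"
      by (intro continuous_on_mult continuous_on_of_real_powr smooth_kernel_continuous[OF H])
         (use w ab in \<open>auto intro!: continuous_intros\<close>)
    fix r assume r: "r \<in> {0<..<a}"
    have "((\<lambda>z. z powr w) has_field_derivative w * of_real r powr (w - 1)) (at (complex_of_real r))"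
      using r by (intro has_field_derivative_powr) auto
    from has_vector_derivative_real_field[OF this, of UNIV]
    have "((\<lambda>r. of_real r powr w) has_vector_derivative w * of_real r powr (w - 1)) (at r)" .
    from has_vector_derivative_mult[OF this der[of r \<zeta> s]] ab[of r] r
    show "((\<lambda>r. of_real r powr w * H \<zeta> s r) has_vector_derivative
        of_real r powr (w - 1) * w * H \<zeta> s r + of_real r powr w * (of_real r * H1 \<zeta> s r)) (at r)"
      by (simp add: algebra_simps)
  qed (use a in auto)
  have "of_real r powr w * (of_real r * H1 \<zeta> s r) =
      of_real r powr (\<zeta> + of_nat (m + 2)) * H1 \<zeta> s r" if "r \<in> {0..a}" for r
  proof (cases "r = 0")
    case False
    then have "complex_of_real r powr (w + 1) = of_real r powr w * of_real r"
      by (simp add: powr_add)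
    moreover have "w + 1 = \<zeta> + of_nat (m + 2)" by (simp add: w_def)
    ultimately show ?thesis by simp
  qed auto
  then have "((\<lambda>r. of_real r powr (w - 1) * w * H \<zeta> s r + of_real r powr (\<zeta> + of_nat (m + 2)) * H1 \<zeta> s r)
      has_integral of_real a powr w * H \<zeta> s a - of_real 0 powr w * H \<zeta> s 0) {0..a}"
    by (intro has_integral_eq[OF _ total] arg_cong2[of _ _ _ _ "(+)"] refl)
  from has_integral_divide[OF has_integral_diff[OF this i2], of w]
  have "((\<lambda>r. of_real r powr (w - 1) * w * H \<zeta> s r / w) has_integral
    (of_real a powr w * H \<zeta> s a
      - integral {0..a} (\<lambda>r. of_real r powr (\<zeta> + of_nat (m + 2)) * H1 \<zeta> s r)) / w) {0..a}"
    by (simp only: add_diff_cancel_right' of_real_0 powr_0 mult_zero_left diff_0_right)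
  moreover have "of_real r powr (w - 1) * w * H \<zeta> s r / w = of_real r powr (\<zeta> + of_nat m) * H \<zeta> s r" for r
    using w(2) by (simp add: w_def)
  ultimately show ?thesis by (simp only: w_def)
qed

lemma mellin_by_parts:
  assumes "even_kernel b H" "even_kernel b H1"
    and "\<And>\<zeta> s r. \<bar>r\<bar> < b \<Longrightarrow> ((\<lambda>r. H \<zeta> s r) has_vector_derivative of_real r * H1 \<zeta> s r) (at r)"
    and a: "0 < a" "a < b" and re: "- 1 < Re (\<zeta> + of_nat m)"
  shows "mellin L a m H \<zeta> =
    (of_real a powr (\<zeta> + of_nat m + 1) * integral {0..L} (\<lambda>s. H \<zeta> s a) - mellin L a (m + 2) H1 \<zeta>)
      / (\<zeta> + of_nat m + 1)"
proof -
  have sk: "smooth_kernel b H" "smooth_kernel b H1" using assms by (auto simp: even_kernel_def)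
  have inner: "integral {0..a} (\<lambda>r. of_real r powr (\<zeta> + of_nat m) * H \<zeta> s r) =
    (of_real a powr (\<zeta> + of_nat m + 1) * H \<zeta> s a
      - integral {0..a} (\<lambda>r. of_real r powr (\<zeta> + of_nat (m + 2)) * H1 \<zeta> s r)) / (\<zeta> + of_nat m + 1)" for s
    by (rule integral_unique[OF mellin_inner_by_parts[OF sk assms(3-6)]])
  have i1: "(\<lambda>s. H \<zeta> s a) integrable_on {0..L}"
    using a by (intro integrable_continuous_interval smooth_kernel_continuous[OF sk(1)] continuous_intros) auto
  have i2: "(\<lambda>s. integral {0..a} (\<lambda>r. of_real r powr (\<zeta> + of_nat (m + 2)) * H1 \<zeta> s r)) integrable_on {0..L}"
    using re by (intro integrable_continuous_interval mellin_inner_continuous[OF sk(2) a(2)]) auto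
  show ?thesis unfolding mellin_def inner
    by (simp add: divide_inverse integral_diff[OF integrable_on_mult_right[OF i1] i2, simplified]
        del: of_nat_add)
qed

text \<open>For -1 < Re \<zeta> \<le> 0 continuity of the integrand at r = 0 may fail, so
  integrability in r, and then in s, is read off from the formula after integration by parts, whose
  terms are continuous.\<close>

lemma mellin_add:
  assumes "even_kernel b H" "even_kernel b K" and a: "0 < a" "a < b" and re: "- 1 < Re \<zeta>"
  shows "mellin L a 0 (\<lambda>\<zeta> s r. H \<zeta> s r + K \<zeta> s r) \<zeta> = mellin L a 0 H \<zeta> + mellin L a 0 K \<zeta>"
proof -
  have inner: "(\<lambda>r. of_real r powr \<zeta> * H \<zeta> s r) integrable_on {0..a}"
    and outer: "(\<lambda>s. integral {0..a} (\<lambda>r. of_real r powr \<zeta> * H \<zeta> s r)) integrable_on {0..L}"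
    if "even_kernel b H" for H s
  proof -
    obtain H1 where H1: "even_kernel b H1"
      "\<And>\<zeta> s r. \<bar>r\<bar> < b \<Longrightarrow> ((\<lambda>r. H \<zeta> s r) has_vector_derivative of_real r * H1 \<zeta> s r) (at r)"
      by (rule even_kernel_derivative[OF \<open>even_kernel b H\<close>]) blast
    have sk: "smooth_kernel b H" "smooth_kernel b H1"
      using \<open>even_kernel b H\<close> H1(1) by (auto simp: even_kernel_def)
    note ibp = mellin_inner_by_parts[OF sk H1(2) a, of \<zeta> 0, simplified, OF re]
    show "(\<lambda>r. of_real r powr \<zeta> * H \<zeta> s r) integrable_on {0..a}"
      using ibp by (rule has_integral_integrable)
    have w: "\<zeta> + 1 \<noteq> 0" using re by (auto simp: complex_eq_iff)
    have "continuous_on {0..L} (\<lambda>s. integral {0..a} (\<lambda>r. of_real r powr (\<zeta> + of_nat 2) * H1 \<zeta> s r))"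
      using re by (intro mellin_inner_continuous[OF sk(2) a(2)]) auto
    then have "continuous_on {0..L} (\<lambda>s. (of_real a powr (\<zeta> + 1) * H \<zeta> s a -
        integral {0..a} (\<lambda>r. of_real r powr (\<zeta> + 2) * H1 \<zeta> s r)) / (\<zeta> + 1))"
      using a w by (intro continuous_intros smooth_kernel_continuous[OF sk(1)]) auto
    then show "(\<lambda>s. integral {0..a} (\<lambda>r. of_real r powr \<zeta> * H \<zeta> s r)) integrable_on {0..L}"
      unfolding integral_unique[OF ibp] by (rule integrable_continuous_interval)
  qed
  show ?thesis
    unfolding mellin_def
    by (simp add: distrib_left integral_add inner[OF assms(1)] inner[OF assms(2)]
        outer[OF assms(1)] outer[OF assms(2)])
qed

section \<open>The exceptional set and continuation strip by strip\<close>

text \<open>The denominators of integration by parts are \<zeta> + m + 1 with m = 0, 2, 4, ..., so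
  their zeros are exceptional points.\<close>

lemma odd_neg_ints_memI: "even m \<Longrightarrow> \<zeta> + of_nat m + 1 = 0 \<Longrightarrow> \<zeta> \<in> odd_neg_ints"
  by (auto simp: odd_neg_ints_def add_eq_0_iff2 add.assoc elim!: evenE)

lemma odd_neg_ints_not_minus_2: "-2 \<notin> odd_neg_ints"
proof
  assume "-2 \<in> odd_neg_ints"
  then obtain k :: nat where "(-2::complex) = - of_nat (2 * k + 1)" by (auto simp: odd_neg_ints_def)
  then have "(of_nat 2 :: complex) = of_nat (2 * k + 1)" by simp
  then have "2 = 2 * k + 1" by (simp only: of_nat_eq_iff)
  then show False by presburger
qed

lemma odd_neg_ints_subset_Ints: "odd_neg_ints \<subseteq> \<int>"
  by (auto simp: odd_neg_ints_def)

lemma open_Compl_odd_neg_ints: "open (- odd_neg_ints)"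
  by (intro open_Compl closed_subset_Ints odd_neg_ints_subset_Ints)

lemma countable_odd_neg_ints: "countable odd_neg_ints"
  by (auto simp: odd_neg_ints_def full_SetCompr_eq)

text \<open>Removing a countable set does not disconnect a plane domain. The identity theorem needs
  this to glue the continuations.\<close>

lemma connected_halfplane_minus_odd_neg_ints: "connected ({\<zeta>. c < Re \<zeta>} - odd_neg_ints)"
  by (intro connected_open_diff_countable countable_odd_neg_ints convex_connected convex_halfspace_Re_gt
      open_halfspace_Re_gt) auto

lemma open_halfplane_minus_odd_neg_ints: "open ({\<zeta>. c < Re \<zeta>} - odd_neg_ints)"
  using open_Int[OF open_halfspace_Re_gt open_Compl_odd_neg_ints] by (simp add: Diff_eq)

text \<open>Each integration by parts gains a strip of width 2 and introduces no singularity except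
  the zero of its denominator. The second clause carries two lower bounds because for
  \<open>n = 0\<close> only Re \<zeta> > -m is covered. The third clause is pointwise in \<zeta>: if
  H(\<zeta>) vanishes for 0 < r < b, then so do its r-derivative, hence H1(\<zeta>), and the
  boundary term at r = a.\<close>

lemma mellin_continuation_step:
  assumes "even_kernel b H" "0 < a" "a < b" "even m"
  shows "\<exists>f. f holomorphic_on ({\<zeta>. - real m - 2 * real n < Re \<zeta>} - odd_neg_ints) \<and>
    (\<forall>\<zeta>. - real m - 1 < Re \<zeta> \<longrightarrow> - real m - 2 * real n < Re \<zeta> \<longrightarrow> f \<zeta> = mellin L a m H \<zeta>) \<and>
    (\<forall>\<zeta>. (\<forall>s. \<forall>r\<in>{0<..<b}. H \<zeta> s r = 0) \<longrightarrow> f \<zeta> = 0)"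
  using assms
proof (induction n arbitrary: m H)
  case 0
  have "mellin L a m H \<zeta> = 0" if "\<forall>s. \<forall>r\<in>{0<..<b}. H \<zeta> s r = 0" for \<zeta>
  proof -
    have "of_real r powr (\<zeta> + of_nat m) * H \<zeta> s r = 0" if "r \<in> {0..a}" for s r
      using that \<open>\<forall>s. \<forall>r\<in>{0<..<b}. H \<zeta> s r = 0\<close> \<open>a < b\<close> by (cases "r = 0") auto
    then have "integral {0..a} (\<lambda>r. of_real r powr (\<zeta> + of_nat m) * H \<zeta> s r) = integral {0..a} (\<lambda>r. 0)" for s
      by (intro integral_cong)
    then show ?thesis by (simp add: mellin_def)
  qed
  moreover have "mellin L a m H holomorphic_on ({\<zeta>. - real m - 2 * real 0 < Re \<zeta>} - odd_neg_ints)"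
    using 0 by (intro holomorphic_on_subset[OF mellin_holomorphic]) (auto simp: even_kernel_def)
  ultimately show ?case by (intro exI[of _ "mellin L a m H"]) auto
next
  case (Suc n)
  obtain H1 where H1: "even_kernel b H1"
    "\<And>\<zeta> s r. \<bar>r\<bar> < b \<Longrightarrow> ((\<lambda>r. H \<zeta> s r) has_vector_derivative of_real r * H1 \<zeta> s r) (at r)"
    by (rule even_kernel_derivative[OF Suc.prems(1)]) blast
  \<comment> \<open>Starting at \<open>m + 2\<close> with \<open>n\<close> steps reaches the same
    half-plane as starting at \<open>m\<close> with \<open>n + 1\<close> steps.\<close>
  from Suc.IH[OF H1(1) Suc.prems(2,3), of "m + 2"] Suc.prems(4)
  obtain f where f: "f holomorphic_on ({\<zeta>. - real m - 2 * real (Suc n) < Re \<zeta>} - odd_neg_ints)"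
    "\<And>\<zeta>. - real m - 3 < Re \<zeta> \<Longrightarrow> - real m - 2 * real (Suc n) < Re \<zeta> \<Longrightarrow> f \<zeta> = mellin L a (m + 2) H1 \<zeta>"
    "\<And>\<zeta>. (\<forall>s. \<forall>r\<in>{0<..<b}. H1 \<zeta> s r = 0) \<Longrightarrow> f \<zeta> = 0"
    by (auto simp: algebra_simps)
  define g where "g \<zeta> = (of_real a powr (\<zeta> + of_nat m + 1) * integral {0..L} (\<lambda>s. H \<zeta> s a) - f \<zeta>)
      / (\<zeta> + of_nat m + 1)" for \<zeta>
  have sk: "smooth_kernel b H" using Suc.prems by (auto simp: even_kernel_def)
  have "(\<lambda>\<zeta>. integral (cbox 0 L) (\<lambda>s. H \<zeta> s a)) holomorphic_on UNIV"
    by (rule holomorphic_on_integral)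
       (use Suc.prems(2,3) in \<open>auto simp: split_beta intro!: smooth_kernel_continuous[OF sk]
          smooth_kernel_holomorphic[OF sk] continuous_intros\<close>)
  then have A: "(\<lambda>\<zeta>. integral {0..L} (\<lambda>s. H \<zeta> s a)) holomorphic_on S" for S
    unfolding cbox_interval by (rule holomorphic_on_subset) simp
  have "g holomorphic_on ({\<zeta>. - real m - 2 * real (Suc n) < Re \<zeta>} - odd_neg_ints)"
    unfolding g_def
    by (intro holomorphic_intros f(1) A)
       (use Suc.prems(2) in \<open>auto dest: odd_neg_ints_memI[OF Suc.prems(4)]\<close>)
  moreover have "g \<zeta> = mellin L a m H \<zeta>" if "- real m - 1 < Re \<zeta>" for \<zeta>
    using that f(2)[of \<zeta>]
    by (subst mellin_by_parts[OF Suc.prems(1) H1 Suc.prems(2,3)]) (auto simp: g_def)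
  moreover have "g \<zeta> = 0" if z: "\<forall>s. \<forall>r\<in>{0<..<b}. H \<zeta> s r = 0" for \<zeta>
  proof -
    have "H1 \<zeta> s r = 0" if r: "r \<in> {0<..<b}" for s r
    proof -
      have "((\<lambda>r. 0) has_vector_derivative of_real r * H1 \<zeta> s r) (at r)"
        by (rule has_vector_derivative_transform_within_open[OF H1(2), where S="{0<..<b}"])
           (use r z in auto)
      then have "of_real r * H1 \<zeta> s r = 0"
        using vector_derivative_unique_at[OF has_vector_derivative_const] by metis
      then show ?thesis using r by simp
    qed
    then have "f \<zeta> = 0" using f(3) by blast
    moreover have "integral {0..L} (\<lambda>s. H \<zeta> s a) = 0" using z Suc.prems(2,3) by simp
    ultimately show ?thesis by (simp add: g_def)
  qed
  ultimately show ?case by (intro exI[of _ g]) auto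
qed

text \<open>The last property says that the value of the continuation at \<open>\<zeta>\<close> only depends on \<open>H \<zeta>\<close>, although
  \<open>f\<close> need not be given by an integral there.\<close>

proposition mellin_continuation:
  assumes "even_kernel b H" "0 < a" "a < b"
  obtains f where "f holomorphic_on (- odd_neg_ints)"
    "\<And>\<zeta>. - 1 < Re \<zeta> \<Longrightarrow> f \<zeta> = mellin L a 0 H \<zeta>"
    "\<And>\<zeta>. \<zeta> \<notin> odd_neg_ints \<Longrightarrow> (\<And>s r. r \<in> {0<..<b} \<Longrightarrow> H \<zeta> s r = 0) \<Longrightarrow> f \<zeta> = 0"
proof -
  define D where "D n = {\<zeta>. - 2 * real n < Re \<zeta>} - odd_neg_ints" for n
  have "\<forall>n. \<exists>f. f holomorphic_on D n \<and>
    (\<forall>\<zeta>. - 1 < Re \<zeta> \<longrightarrow> - 2 * real n < Re \<zeta> \<longrightarrow> f \<zeta> = mellin L a 0 H \<zeta>) \<and>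
    (\<forall>\<zeta>. (\<forall>s. \<forall>r\<in>{0<..<b}. H \<zeta> s r = 0) \<longrightarrow> f \<zeta> = 0)"
    using mellin_continuation_step[OF assms, of 0 _ L] unfolding D_def by simp
  then obtain F where F: "\<And>n. F n holomorphic_on D n"
    "\<And>n \<zeta>. - 1 < Re \<zeta> \<Longrightarrow> - 2 * real n < Re \<zeta> \<Longrightarrow> F n \<zeta> = mellin L a 0 H \<zeta>"
    "\<And>n \<zeta>. (\<forall>s. \<forall>r\<in>{0<..<b}. H \<zeta> s r = 0) \<Longrightarrow> F n \<zeta> = 0" by metis
  have opn: "open (D n)" for n unfolding D_def by (rule open_halfplane_minus_odd_neg_ints)
  have D0: "D 0 = {\<zeta>. 0 < Re \<zeta>}" by (auto simp: D_def odd_neg_ints_def)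
  have mono: "D n \<subseteq> D k" if "n \<le> k" for n k using that by (auto simp: D_def)
  \<comment> \<open>All \<open>F n\<close> equal the integral on the right half-plane
    \<open>D 0\<close>, so the identity theorem makes them agree wherever two of them are
    holomorphic.\<close>
  have agree_le: "F n \<zeta> = F k \<zeta>" if "n \<le> k" "\<zeta> \<in> D n" for n k \<zeta>
  proof (rule analytic_continuation_open[where s="D 0" and s'="D n" and f="F n" and g="F k"])
    show "D 0 \<noteq> {}" unfolding D0 by (auto intro: exI[of _ 1])
    show "connected (D n)" unfolding D_def by (rule connected_halfplane_minus_odd_neg_ints)
    show "F k holomorphic_on D n" using F(1) mono[OF that(1)] by (rule holomorphic_on_subset)
    fix z assume "z \<in> D 0"
    then have "Re z > 0" by (simp add: D0)
    then have "- 2 * real n < Re z" "- 2 * real k < Re z" "- 1 < Re z"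
      using of_nat_0_le_iff[of n, where ?'a=real] of_nat_0_le_iff[of k, where ?'a=real] by linarith+
    then show "F n z = F k z" using F(2)[of z n] F(2)[of z k] by simp
  qed (rule opn F(1) mono[OF le0] that(2))+
  have agree: "F n \<zeta> = F k \<zeta>" if "\<zeta> \<in> D n" "\<zeta> \<in> D k" for n k \<zeta>
    using agree_le[OF _ that(1), of k] agree_le[OF _ that(2), of n] nat_le_linear[of n k] by metis
  \<comment> \<open>The index of a half-plane that contains \<zeta>; the summand 1 makes the
    inequality strict when Re \<zeta> = 0.\<close>
  define N where "N \<zeta> = nat \<lceil>\<bar>Re \<zeta>\<bar>\<rceil> + 1" for \<zeta> :: complex
  define f where "f \<zeta> = F (N \<zeta>) \<zeta>" for \<zeta>
  have N: "- 2 * real (N \<zeta>) < Re \<zeta>" for \<zeta>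
  proof -
    define x where "x = real (nat \<lceil>\<bar>Re \<zeta>\<bar>\<rceil>)"
    have "\<bar>Re \<zeta>\<bar> \<le> x" unfolding x_def by (rule real_nat_ceiling_ge)
    moreover have "real (N \<zeta>) = x + 1" by (simp add: N_def x_def)
    ultimately show ?thesis by linarith
  qed
  then have ND: "\<zeta> \<in> D (N \<zeta>)" if "\<zeta> \<notin> odd_neg_ints" for \<zeta> using that by (auto simp: D_def)
  have "f holomorphic_on D n" for n
  proof -
    have "f \<zeta> = F n \<zeta>" if "\<zeta> \<in> D n" for \<zeta>
      unfolding f_def by (rule agree[OF ND that]) (use that in \<open>auto simp: D_def\<close>)
    then show ?thesis using F(1)[of n] by (simp cong: holomorphic_cong)
  qed
  then have "f holomorphic_on (\<Union>n. D n)" using opn by (intro holomorphic_on_UN_open)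
  moreover have "(\<Union>n. D n) = - odd_neg_ints" using ND by (auto simp: D_def)
  ultimately have "f holomorphic_on (- odd_neg_ints)" by simp
  moreover have "f \<zeta> = mellin L a 0 H \<zeta>" if "- 1 < Re \<zeta>" for \<zeta>
    unfolding f_def by (rule F(2)[OF that N])
  moreover have "f \<zeta> = 0" if "\<And>s r. r \<in> {0<..<b} \<Longrightarrow> H \<zeta> s r = 0" for \<zeta>
    unfolding f_def by (rule F(3)) (use that in blast)
  ultimately show ?thesis using that by blast
qed

section \<open>Double integrals of periodic functions\<close>

lemma set_integrable_abs_powr:
  fixes \<sigma> a :: real
  assumes "- 1 < \<sigma>" "0 \<le> a"
  shows "set_integrable lborel {- a..a} (\<lambda>r. \<bar>r\<bar> powr \<sigma>)"
proof -
  have 1: "(\<lambda>r. \<bar>r\<bar> powr \<sigma>) integrable_on {0..a}"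
    using integrable_on_powr_from_0[OF assms] by (rule integrable_eq) auto
  then have "(\<lambda>r. \<bar>- r\<bar> powr \<sigma>) integrable_on {- a..- 0}"
    by (subst Henstock_Kurzweil_Integration.integrable_reflect_real) 
  then have "(\<lambda>r. \<bar>r\<bar> powr \<sigma>) integrable_on {- a..a}"
    using 1 assms(2) by (intro Henstock_Kurzweil_Integration.integrable_combine[OF _ _ _ 1]) auto
  then have "set_integrable lebesgue {- a..a} (\<lambda>r. \<bar>r\<bar> powr \<sigma>)"
    by (rule nonnegative_absolutely_integrable_1) auto
  then show ?thesis
    unfolding set_integrable_def by (subst (asm) integrable_completion) auto
qed

text \<open>An endpoint is a null set. Half-open intervals are preferred below because their
  translates tile the line without overlap.\<close>

lemma half_open_integral:
  fixes f :: "real \<Rightarrow> 'b::{banach, second_countable_topology}"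
  assumes "f \<in> borel_measurable borel"
  shows "set_integrable lborel {u..<v} f \<longleftrightarrow> set_integrable lborel {u..v} f"
    and "(LINT x:{u..<v}|lborel. f x) = (LINT x:{u..v}|lborel. f x)"
proof -
  have "AE x in lborel. indicator {u..<v} x *\<^sub>R f x = indicator {u..v} x *\<^sub>R f x"
    using AE_lborel_singleton[of v] by eventually_elim (auto simp: indicator_def)
  with assms show "set_integrable lborel {u..<v} f \<longleftrightarrow> set_integrable lborel {u..v} f"
    and "(LINT x:{u..<v}|lborel. f x) = (LINT x:{u..v}|lborel. f x)"
    unfolding set_integrable_def set_lebesgue_integral_def
    by (intro integrable_cong_AE integral_cong_AE; simp)+
qed

text \<open>The bounds on \<open>c\<close> place the window [c, c + L) inside [-L, 2L). Cutting it
  at 0 and L gives pieces which, moved by a period where necessary, fill [0, L) exactly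
  once.\<close>

lemma periodic_set_integral:
  fixes f :: "real \<Rightarrow> 'b::{banach, second_countable_topology}"
  assumes meas: "f \<in> borel_measurable borel" and per: "\<And>x. f (x + L) = f x"
    and L: "0 < L" and c: "- L \<le> c" "c \<le> L"
    and int: "set_integrable lborel {c..c + L} f"
  shows "set_integrable lborel {0..L} f"
    and "(LINT x:{0..L}|lborel. f x) = (LINT x:{c..c + L}|lborel. f x)"
proof -
  define q where "q x = indicator {c..<c + L} x *\<^sub>R f x" for x
  have q: "integrable lborel q"
    using half_open_integral(1)[OF meas, of c "c + L"] int by (simp add: set_integrable_def q_def[abs_def])
  have q_shift: "integrable lborel (\<lambda>x. q (d + x))" for d
    using lborel_integrable_real_affine[OF q, of 1 d] by simp
  have shifted: "integrable lborel (\<lambda>x. indicator {0..<L} x *\<^sub>R q (d + x))"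
    "(\<integral>x. indicator {0..<L} x *\<^sub>R q (d + x) \<partial>lborel) = (\<integral>x. indicator {d..<d + L} x *\<^sub>R q x \<partial>lborel)" for d
  proof -
    show "integrable lborel (\<lambda>x. indicator {0..<L} x *\<^sub>R q (d + x))"
      by (intro integrable_mult_indicator q_shift) auto
    have "(\<integral>x. indicator {d..<d + L} x *\<^sub>R q x \<partial>lborel) =
        (\<integral>x. indicator {d..<d + L} (d + x) *\<^sub>R q (d + x) \<partial>lborel)"
      using lborel_integral_real_affine[of 1 "\<lambda>x. indicator {d..<d + L} x *\<^sub>R q x" d] by simp
    then show "(\<integral>x. indicator {0..<L} x *\<^sub>R q (d + x) \<partial>lborel) = (\<integral>x. indicator {d..<d + L} x *\<^sub>R q x \<partial>lborel)"
      by (simp add: indicator_def)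
  qed
  have per': "f (x - L) = f x" "f (- L + x) = f x" "f (L + x) = f x" for x
    using per[of "x - L"] per[of x] by (simp_all add: add.commute)
  \<comment> \<open>For x in [0, L) exactly one of x - L, x, x + L lies in the window.\<close>
  have split: "indicator {0..<L} x *\<^sub>R f x = indicator {0..<L} x *\<^sub>R q (- L + x) +
      indicator {0..<L} x *\<^sub>R q (0 + x) + indicator {0..<L} x *\<^sub>R q (L + x)" for x
    using c by (auto simp: q_def indicator_def per')
  \<comment> \<open>The three half-open periods together contain the support of
    \<open>q\<close>.\<close>
  have join: "q x = indicator {- L..<- L + L} x *\<^sub>R q x + indicator {0..<0 + L} x *\<^sub>R q x +
      indicator {L..<L + L} x *\<^sub>R q x" for x
    using c by (auto simp: q_def indicator_def)
  have i: "set_integrable lborel {0..<L} f"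
    unfolding set_integrable_def split by (intro Bochner_Integration.integrable_add shifted)
  then show "set_integrable lborel {0..L} f" by (simp add: half_open_integral[OF meas])
  have piece: "integrable lborel (\<lambda>x. indicator {d..<d + L} x *\<^sub>R q x)" for d
    by (intro integrable_mult_indicator q) auto
  have "(LINT x:{0..<L}|lborel. f x) = (\<integral>x. indicator {- L..<- L + L} x *\<^sub>R q x \<partial>lborel) +
      (\<integral>x. indicator {0..<0 + L} x *\<^sub>R q x \<partial>lborel) + (\<integral>x. indicator {L..<L + L} x *\<^sub>R q x \<partial>lborel)"
    unfolding set_lebesgue_integral_def split
    by (simp only: Bochner_Integration.integral_add Bochner_Integration.integrable_add shifted)
  also have "\<dots> = (\<integral>x. indicator {- L..<- L + L} x *\<^sub>R q x + indicator {0..<0 + L} x *\<^sub>R q x +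
      indicator {L..<L + L} x *\<^sub>R q x \<partial>lborel)"
    by (simp only: Bochner_Integration.integral_add Bochner_Integration.integrable_add piece)
  also have "\<dots> = integral\<^sup>L lborel q" by (simp only: join[symmetric])
  finally show "(LINT x:{0..L}|lborel. f x) = (LINT x:{c..c + L}|lborel. f x)"
    unfolding half_open_integral[OF meas, symmetric] by (simp add: q_def[abs_def] set_lebesgue_integral_def)
qed

text \<open>The window [s - L/2, s + L/2] puts the diagonal t = s at its centre r = 0.\<close>

lemma periodic_set_integral_centered:
  fixes f :: "real \<Rightarrow> 'b::{banach, second_countable_topology}"
  assumes meas: "f \<in> borel_measurable borel" and per: "\<And>x. f (x + L) = f x"
    and L: "0 < L" and s: "s \<in> {0..L}"
    and int: "set_integrable lborel {- (L/2)..L/2} (\<lambda>r. f (s + r))"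
  shows "set_integrable lborel {0..L} f"
    and "(LINT x:{0..L}|lborel. f x) = (LINT r:{- (L/2)..L/2}|lborel. f (s + r))"
proof -
  have ind: "indicat_real {- (L/2)..L/2} (x - s) = indicator {s - L/2..L/2 + s} x" for x
    by (auto simp: indicator_def)
  have "integrable lborel (\<lambda>x. indicator {- (L/2)..L/2} (- s + 1 * x) *\<^sub>R f (s + (- s + 1 * x)))"
    using int unfolding set_integrable_def by (rule lborel_integrable_real_affine) simp
  then have i: "set_integrable lborel {s - L/2..s - L/2 + L} f"
    by (simp add: set_integrable_def ind)
  have "(LINT r:{- (L/2)..L/2}|lborel. f (s + r)) = (LINT x:{s - L/2..s - L/2 + L}|lborel. f x)"
    unfolding set_lebesgue_integral_def
    using lborel_integral_real_affine[of 1 "\<lambda>r. indicator {- (L/2)..L/2} r *\<^sub>R f (s + r)" "- s"]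
    by (simp add: ind)
  then show "set_integrable lborel {0..L} f"
    and "(LINT x:{0..L}|lborel. f x) = (LINT r:{- (L/2)..L/2}|lborel. f (s + r))"
    using periodic_set_integral[OF meas per L _ _ i] s by auto
qed

text \<open>On the square {0..L} \<times> {0..L} a kernel singular on the diagonal is by periodicity
  also singular at the corners (0, L) and (L, 0). Centring each row at s moves all singularities to
  r = 0, where one integrable bound serves every row.\<close>

lemma periodic_double_integral:
  fixes k :: "real \<Rightarrow> real \<Rightarrow> complex"
  assumes meas: "(\<lambda>p. k (fst p) (snd p)) \<in> borel_measurable borel"
    and per: "\<And>s t. k s (t + L) = k s t" and L: "0 < L" and \<sigma>: "- 1 < \<sigma>"
    and bound: "\<And>s r. s \<in> {0..L} \<Longrightarrow> \<bar>r\<bar> \<le> L/2 \<Longrightarrow> r \<noteq> 0 \<Longrightarrow> cmod (k s (s + r)) \<le> C * \<bar>r\<bar> powr \<sigma>"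
  shows "s \<in> {0..L} \<Longrightarrow> (\<lambda>r. k s (s + r)) integrable_on {- (L/2)..L/2}"
    and "(LINT st:{0..L} \<times> {0..L}|lborel. k (fst st) (snd st)) =
      integral {0..L} (\<lambda>s. integral {- (L/2)..L/2} (\<lambda>r. k s (s + r)))"
proof -
  have meas1: "k s \<in> borel_measurable borel" for s
    using measurable_compose[OF borel_measurable_Pair[OF measurable_const[of s] measurable_ident_sets[OF refl]] meas]
    by simp
  have dom: "set_integrable lborel {- (L/2)..L/2} (\<lambda>r. C * \<bar>r\<bar> powr \<sigma>)"
    using L by (intro set_integrable_mult_right set_integrable_abs_powr[OF \<sigma>]) auto
  define M where "M = (LINT r:{- (L/2)..L/2}|lborel. C * \<bar>r\<bar> powr \<sigma>)"
  have inner: "set_integrable lborel {- (L/2)..L/2} (\<lambda>r. k s (s + r))" if s: "s \<in> {0..L}" for s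
    unfolding set_integrable_def
  proof (rule Bochner_Integration.integrable_bound[OF dom[unfolded set_integrable_def]])
    show "AE r in lborel. norm (indicator {- (L/2)..L/2} r *\<^sub>R k s (s + r)) \<le>
        norm (indicator {- (L/2)..L/2} r *\<^sub>R (C * \<bar>r\<bar> powr \<sigma>))"
      using AE_lborel_singleton[of 0]
      by eventually_elim (use bound[OF s] in \<open>auto simp: indicator_def intro: order_trans[OF _ abs_ge_self]\<close>)
    have "(\<lambda>r. k s (s + r)) \<in> borel_measurable borel"
      by (rule measurable_compose[OF _ meas1]) simp
    then show "(\<lambda>r. indicator {- (L/2)..L/2} r *\<^sub>R k s (s + r)) \<in> borel_measurable lborel"
      by simp
  qed
  then show "(\<lambda>r. k s (s + r)) integrable_on {- (L/2)..L/2}" if "s \<in> {0..L}" for s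
    using that set_borel_integral_eq_integral(1) by blast
  have row: "set_integrable lborel {0..L} (k s)"
    "(LINT t:{0..L}|lborel. k s t) = integral {- (L/2)..L/2} (\<lambda>r. k s (s + r))"
    "(LINT t:{0..L}|lborel. cmod (k s t)) \<le> M" if s: "s \<in> {0..L}" for s
  proof -
    note c = periodic_set_integral_centered[OF meas1 per L s inner[OF s]]
    show "set_integrable lborel {0..L} (k s)" by (rule c(1))
    show "(LINT t:{0..L}|lborel. k s t) = integral {- (L/2)..L/2} (\<lambda>r. k s (s + r))"
      unfolding c(2) by (rule set_borel_integral_eq_integral(2)[OF inner[OF s]])
    have n: "set_integrable lborel {- (L/2)..L/2} (\<lambda>r. cmod (k s (s + r)))"
      by (rule set_integrable_norm[OF inner[OF s]])
    have nm: "(\<lambda>t. cmod (k s t)) \<in> borel_measurable borel"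
      by (rule measurable_compose[OF meas1]) simp
    have "(LINT t:{0..L}|lborel. cmod (k s t)) = (LINT r:{- (L/2)..L/2}|lborel. cmod (k s (s + r)))"
      by (rule periodic_set_integral_centered(2)[OF nm _ L s n]) (simp add: per)
    also have "\<dots> \<le> M"
      unfolding M_def set_lebesgue_integral_def
    proof (rule integral_mono_AE)
      show "AE r in lborel. indicator {- (L/2)..L/2} r *\<^sub>R cmod (k s (s + r)) \<le>
          indicator {- (L/2)..L/2} r *\<^sub>R (C * \<bar>r\<bar> powr \<sigma>)"
        using AE_lborel_singleton[of 0]
        by eventually_elim (use bound[OF s] in \<open>auto simp: indicator_def\<close>)
    qed (use n dom in \<open>auto simp: set_integrable_def\<close>)
    finally show "(LINT t:{0..L}|lborel. cmod (k s t)) \<le> M" .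
  qed
  define F where "F p = indicator ({0..L} \<times> {0..L}) p *\<^sub>R k (fst p) (snd p)" for p
  have F_eq: "F (s, t) = indicator {0..L} s *\<^sub>R (indicator {0..L} t *\<^sub>R k s t)" for s t
    by (auto simp: F_def indicator_def)
  have F_meas: "F \<in> borel_measurable (lborel \<Otimes>\<^sub>M lborel)"
    unfolding F_def[abs_def] lborel_prod using meas
    by (intro borel_measurable_scaleR borel_measurable_indicator) (auto simp: closed_Times borel_closed)
  have F_int: "integrable (lborel \<Otimes>\<^sub>M lborel) F"
  \<comment> \<open>Each row is integrable, and the bound \<open>M\<close> on the row norms is
    uniform in s, so the norms are integrable over the bounded interval.\<close>
  proof (rule lborel_pair.Fubini_integrable[OF F_meas])
    show "AE s in lborel. integrable lborel (\<lambda>t. F (s, t))"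
    proof (rule AE_I2)
      fix s show "integrable lborel (\<lambda>t. F (s, t))"
        using row(1)[of s] by (cases "s \<in> {0..L}") (auto simp: F_eq set_integrable_def)
    qed
    show "integrable lborel (\<lambda>s. \<integral>t. norm (F (s, t)) \<partial>lborel)"
    proof (rule Bochner_Integration.integrable_bound[where f="\<lambda>s. indicator {0..L} s *\<^sub>R M"])
      show "integrable lborel (\<lambda>s. indicator {0..L} s *\<^sub>R M)"
        by (intro integrable_scaleR_left integrable_real_indicator) (auto simp: emeasure_lborel_Icc_eq)
      show "(\<lambda>s. \<integral>t. norm (F (s, t)) \<partial>lborel) \<in> borel_measurable lborel"
        using F_meas by measurable
      have "(\<integral>t. norm (F (s, t)) \<partial>lborel) = indicator {0..L} s * (LINT t:{0..L}|lborel. cmod (k s t))" for s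
        by (simp add: F_eq set_lebesgue_integral_def abs_indicator mult.assoc)
      moreover have "0 \<le> (LINT t:{0..L}|lborel. cmod (k s t))" for s
        unfolding set_lebesgue_integral_def by (intro integral_nonneg_AE) auto
      ultimately show "AE s in lborel. norm (\<integral>t. norm (F (s, t)) \<partial>lborel) \<le> norm (indicator {0..L} s *\<^sub>R M)"
        using row(3) by (intro AE_I2) (auto simp: indicator_def intro: order_trans[OF _ abs_ge_self])
    qed
  qed
  have F_row: "(\<integral>t. F (s, t) \<partial>lborel) = indicator {0..L} s *\<^sub>R integral {- (L/2)..L/2} (\<lambda>r. k s (s + r))" for s
    using row(2)[of s] by (cases "s \<in> {0..L}") (auto simp: F_eq set_lebesgue_integral_def)
  have outer: "set_integrable lborel {0..L} (\<lambda>s. integral {- (L/2)..L/2} (\<lambda>r. k s (s + r)))"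
    using lborel_pair.integrable_fst'[OF F_int] unfolding set_integrable_def F_row .
  have "(LINT st:{0..L} \<times> {0..L}|lborel. k (fst st) (snd st)) = integral\<^sup>L (lborel \<Otimes>\<^sub>M lborel) F"
    unfolding set_lebesgue_integral_def F_def[abs_def] lborel_prod ..
  also have "\<dots> = (\<integral>s. \<integral>t. F (s, t) \<partial>lborel \<partial>lborel)"
    by (rule lborel_pair.integral_fst'[OF F_int, symmetric])
  also have "\<dots> = (LINT s:{0..L}|lborel. integral {- (L/2)..L/2} (\<lambda>r. k s (s + r)))"
    unfolding F_row set_lebesgue_integral_def ..
  also have "\<dots> = integral {0..L} (\<lambda>s. integral {- (L/2)..L/2} (\<lambda>r. k s (s + r)))"
    by (rule set_borel_integral_eq_integral(2)[OF outer])
  finally show "(LINT st:{0..L} \<times> {0..L}|lborel. k (fst st) (snd st)) =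
      integral {0..L} (\<lambda>s. integral {- (L/2)..L/2} (\<lambda>r. k s (s + r)))" .
qed

text \<open>The half r < 0 is reflected onto r > 0. The two halves carry the same power of r, so
  their smooth factors add up to the symmetrised kernel.\<close>

lemma double_integral_eq_mellin:
  fixes k :: "real \<Rightarrow> real \<Rightarrow> complex"
  assumes meas: "(\<lambda>p. k (fst p) (snd p)) \<in> borel_measurable borel"
    and per: "\<And>s t. k s (t + L) = k s t" and L: "0 < L" "L \<le> b" and re: "- 1 < Re \<zeta>"
    and g: "smooth_kernel b g"
    and k_eq: "\<And>s r. 0 < \<bar>r\<bar> \<Longrightarrow> \<bar>r\<bar> < b \<Longrightarrow> k s (s + r) = of_real \<bar>r\<bar> powr \<zeta> * g \<zeta> s r"
  shows "(LINT st:{0..L} \<times> {0..L}|lborel. k (fst st) (snd st)) =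
    mellin L (L/2) 0 (\<lambda>\<zeta> s r. g \<zeta> s r + g \<zeta> s (- r)) \<zeta>"
proof -
  \<comment> \<open>Since L/2 < b, this closed rectangle lies in the domain of continuity of
    \<open>g\<close>, and compactness gives a bound that is uniform in s and r.\<close>
  have "continuous_on ({0..L} \<times> {- (L/2)..L/2}) (\<lambda>p. g \<zeta> (fst p) (snd p))"
    using L by (intro smooth_kernel_continuous[OF g] continuous_intros) auto
  then have "compact ((\<lambda>p. g \<zeta> (fst p) (snd p)) ` ({0..L} \<times> {- (L/2)..L/2}))"
    by (intro compact_continuous_image compact_Times) auto
  then obtain C where "\<forall>x\<in>(\<lambda>p. g \<zeta> (fst p) (snd p)) ` ({0..L} \<times> {- (L/2)..L/2}). cmod x \<le> C"
    using compact_imp_bounded bounded_iff by metis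
  then have C: "cmod (g \<zeta> s r) \<le> C" if "s \<in> {0..L}" "r \<in> {- (L/2)..L/2}" for s r
    using that by force
  have bound: "cmod (k s (s + r)) \<le> C * \<bar>r\<bar> powr Re \<zeta>"
    if "s \<in> {0..L}" "\<bar>r\<bar> \<le> L/2" "r \<noteq> 0" for s r
  proof -
    have "cmod (k s (s + r)) = \<bar>r\<bar> powr Re \<zeta> * cmod (g \<zeta> s r)"
      using that L by (subst k_eq) (auto simp: norm_mult norm_powr_real_powr)
    also have "\<dots> \<le> \<bar>r\<bar> powr Re \<zeta> * C"
      using that by (intro mult_left_mono C) auto
    finally show ?thesis by (simp add: mult.commute)
  qed
  have integrable: "(\<lambda>r. k s (s + r)) integrable_on {- (L/2)..L/2}" if "s \<in> {0..L}" for s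
    by (rule periodic_double_integral(1)[OF meas per L(1) re bound that])
  have double: "(LINT st:{0..L} \<times> {0..L}|lborel. k (fst st) (snd st)) =
      integral {0..L} (\<lambda>s. integral {- (L/2)..L/2} (\<lambda>r. k s (s + r)))"
    by (rule periodic_double_integral(2)[OF meas per L(1) re bound])
  have "integral {- (L/2)..L/2} (\<lambda>r. k s (s + r)) =
    integral {0..L/2} (\<lambda>r. of_real r powr (\<zeta> + of_nat 0) * (g \<zeta> s r + g \<zeta> s (- r)))" if s: "s \<in> {0..L}" for s
  proof -
    note i = integrable[OF s]
    have i_left: "(\<lambda>r. k s (s + r)) integrable_on {- (L/2)..0}"
      and i_right: "(\<lambda>r. k s (s + r)) integrable_on {0..L/2}"
      using L by (auto intro: integrable_on_subinterval[OF i])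
    have i_left': "(\<lambda>r. k s (s + - r)) integrable_on {0..L/2}"
      using i_left Henstock_Kurzweil_Integration.integrable_reflect_real[of "\<lambda>r. k s (s + - r)" "L/2" 0] by simp
    have "integral {- (L/2)..L/2} (\<lambda>r. k s (s + r)) =
        integral {- (L/2)..0} (\<lambda>r. k s (s + r)) + integral {0..L/2} (\<lambda>r. k s (s + r))"
      using L i by (intro Henstock_Kurzweil_Integration.integral_combine[symmetric]) auto
    also have "integral {- (L/2)..0} (\<lambda>r. k s (s + r)) = integral {0..L/2} (\<lambda>r. k s (s + - r))"
      using Henstock_Kurzweil_Integration.integral_reflect_real[of "L/2" 0 "\<lambda>r. k s (s + - r)"] by simp
    also have "integral {0..L/2} (\<lambda>r. k s (s + - r)) + integral {0..L/2} (\<lambda>r. k s (s + r)) =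
        integral {0..L/2} (\<lambda>r. k s (s + - r) + k s (s + r))"
      by (rule Henstock_Kurzweil_Integration.integral_add[symmetric, OF i_left' i_right])
    also have "\<dots> = integral {0..L/2} (\<lambda>r. of_real r powr (\<zeta> + of_nat 0) * (g \<zeta> s r + g \<zeta> s (- r)))"
    \<comment> \<open>The factorisation of \<open>k\<close> is assumed off the diagonal; r = 0 is a
      null set.\<close>
    proof (rule integral_spike[of "{0}"])
      fix r assume r: "r \<in> {0..L/2} - {0}"
      then have "k s (s + - r) = of_real r powr \<zeta> * g \<zeta> s (- r)" "k s (s + r) = of_real r powr \<zeta> * g \<zeta> s r"
        using k_eq[of "- r" s] k_eq[of r s] L by auto
      then show "of_real r powr (\<zeta> + of_nat 0) * (g \<zeta> s r + g \<zeta> s (- r)) = k s (s + - r) + k s (s + r)"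
        by (simp add: distrib_left)
    qed auto
    finally show ?thesis .
  qed
  then show ?thesis unfolding double mellin_def by (intro integral_cong)
qed

section \<open>Legendrian knots in a null lift\<close>

text \<open>The witness is a sequence of all derivatives, as in \<open>smooth_curve\<close>, because
  this is the premise of the rule \<open>translate\<close>.\<close>

definition csmooth :: "(real \<Rightarrow> complex) \<Rightarrow> bool" where
  "csmooth f \<longleftrightarrow> (\<exists>D :: nat \<Rightarrow> real \<Rightarrow> complex. D 0 = f \<and>
     (\<forall>n t. (D n has_vector_derivative D (Suc n) t) (at t)))"

lemma csmooth_imp_smooth_kernel: "csmooth f \<Longrightarrow> smooth_kernel b (\<lambda>\<zeta> s r. f (s + r))"
  unfolding csmooth_def using smooth_kernel.translate[where n=0] by blast

lemma csmooth_derivative: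
  assumes "csmooth f"
  obtains f' where "csmooth f'" "\<And>t. (f has_vector_derivative f' t) (at t)"
proof -
  obtain D where D: "D 0 = f" "\<And>n t. (D n has_vector_derivative D (Suc n) t) (at t)"
    using assms unfolding csmooth_def by blast
  then have "csmooth (D 1)" unfolding csmooth_def by (intro exI[of _ "\<lambda>n. D (Suc n)"]) auto
  with D(1) D(2)[of 0] that[of "D 1"] show ?thesis by simp
qed

lemma csmooth_continuous: "csmooth f \<Longrightarrow> continuous_on A f"
  by (metis csmooth_derivative continuous_at_imp_continuous_on has_vector_derivative_continuous)

lemma has_vector_derivative_translate:
  fixes f :: "real \<Rightarrow> 'a::real_normed_vector"
  shows "((\<lambda>r. f (s + r)) has_vector_derivative f') (at r) \<longleftrightarrow> (f has_vector_derivative f') (at (s + r))"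
proof
  assume "((\<lambda>r. f (s + r)) has_vector_derivative f') (at r)"
  moreover have "((\<lambda>x. x - s) has_vector_derivative 1) (at (s + r))"
    by (auto intro!: derivative_eq_intros)
  ultimately show "(f has_vector_derivative f') (at (s + r))"
    using vector_diff_chain_at[of "\<lambda>x. x - s" 1 "s + r" "\<lambda>r. f (s + r)" f'] by (simp add: o_def)
next
  assume "(f has_vector_derivative f') (at (s + r))"
  moreover have "((\<lambda>r. s + r) has_vector_derivative 1) (at r)"
    by (auto intro!: derivative_eq_intros)
  ultimately show "((\<lambda>r. f (s + r)) has_vector_derivative f') (at r)"
    using vector_diff_chain_at[of "\<lambda>r. s + r" 1 r f f'] by (simp add: o_def)
qed

text \<open>The way back from kernels to curves. It transfers the closure rules of the class to
  smooth functions, in place of formulas for n-th derivatives of products and quotients.\<close>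

lemma smooth_kernel_imp_csmooth:
  assumes F: "smooth_kernel b F" and b: "0 < b"
    and eq: "\<And>s r. \<bar>r\<bar> < b \<Longrightarrow> F 0 s r = f (s + r)"
  shows "csmooth f"
proof -
  define P where "P G G' \<longleftrightarrow> smooth_kernel b G' \<and>
    (\<forall>\<zeta> s r. \<bar>r\<bar> < b \<longrightarrow> ((\<lambda>r. G \<zeta> s r) has_vector_derivative G' \<zeta> s r) (at r))"
    for G G' :: "complex \<Rightarrow> real \<Rightarrow> real \<Rightarrow> complex"
  \<comment> \<open>A choice of derivative kernel, fixed so that differentiation can be
    iterated.\<close>
  define next_kernel where "next_kernel G = (SOME G'. P G G')" for G
  have nxt: "P G (next_kernel G)" if "smooth_kernel b G" for G
    unfolding next_kernel_def
  proof (rule someI_ex[of "P G"])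
    from \<open>smooth_kernel b G\<close> show "\<exists>G'. P G G'"
      by (rule smooth_kernel_derivative) (auto simp: P_def)
  qed
  define FF where "FF n = (next_kernel ^^ n) F" for n
  have sk: "smooth_kernel b (FF n)" for n
    by (induction n) (use F nxt in \<open>auto simp: FF_def P_def\<close>)
  have der: "((\<lambda>r. FF n \<zeta> s r) has_vector_derivative FF (Suc n) \<zeta> s r) (at r)" if "\<bar>r\<bar> < b" for n \<zeta> s r
    using nxt[OF sk[of n]] that by (simp add: FF_def P_def)
  \<comment> \<open>The n-th derivative of \<open>f\<close> at t is read off at base point t and r =
    0. That \<open>FF n 0 s r\<close> depends on s + r alone follows inductively from uniqueness of
    derivatives.\<close>
  define D where "D n t = (if n = 0 then f t else FF n 0 t 0)" for n t
  have D: "FF n 0 s r = D n (s + r) \<and> (D n has_vector_derivative FF (Suc n) 0 s r) (at (s + r))"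
    if "\<bar>r\<bar> < b" for n s r
    using that
  proof (induction n arbitrary: s r)
    case 0
    have "((\<lambda>r. f (s + r)) has_vector_derivative FF (Suc 0) 0 s r) (at r)"
      by (rule has_vector_derivative_transform_within_open[OF der[OF 0, of 0 0 s], where S="{-b<..<b}"])
         (use 0 eq in \<open>auto simp: FF_def\<close>)
    then show ?case using eq[OF 0, of s] unfolding has_vector_derivative_translate
      by (simp add: FF_def D_def[abs_def])
  next
    case (Suc n)
    have *: "FF (Suc n) 0 s r = D (Suc n) (s + r)" if "\<bar>r\<bar> < b" for s r
      using vector_derivative_unique_at[OF conjunct2[OF Suc.IH[OF that, of s]]]
        Suc.IH[of 0 "s + r"] b by (simp add: D_def)
    have "((\<lambda>r. D (Suc n) (s + r)) has_vector_derivative FF (Suc (Suc n)) 0 s r) (at r)"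
      by (rule has_vector_derivative_transform_within_open[OF der[OF Suc.prems, of "Suc n" 0 s], where S="{-b<..<b}"])
         (use Suc.prems * in auto)
    then show ?case using *[OF Suc.prems] unfolding has_vector_derivative_translate by blast
  qed
  have "(D n has_vector_derivative D (Suc n) t) (at t)" for n t
    using D[of 0 n t] b by (simp add: D_def)
  then show ?thesis unfolding csmooth_def by (intro exI[of _ D]) (auto simp: D_def)
qed

lemma csmooth_const: "csmooth (\<lambda>t. c)"
  by (rule smooth_kernel_imp_csmooth[OF smooth_kernel_const[of 1 c]]) auto

lemma csmooth_add: "csmooth f \<Longrightarrow> csmooth g \<Longrightarrow> csmooth (\<lambda>t. f t + g t)"
  by (rule smooth_kernel_imp_csmooth[OF smooth_kernel.add[OF csmooth_imp_smooth_kernel csmooth_imp_smooth_kernel, of f g 1]]) auto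

lemma csmooth_mult: "csmooth f \<Longrightarrow> csmooth g \<Longrightarrow> csmooth (\<lambda>t. f t * g t)"
  by (rule smooth_kernel_imp_csmooth[OF smooth_kernel.mult[OF csmooth_imp_smooth_kernel csmooth_imp_smooth_kernel, of f g 1]]) auto

lemma csmooth_divide: "csmooth f \<Longrightarrow> csmooth g \<Longrightarrow> (\<And>t. g t \<noteq> 0) \<Longrightarrow> csmooth (\<lambda>t. f t / g t)"
  by (rule smooth_kernel_imp_csmooth[OF smooth_kernel.mult[OF csmooth_imp_smooth_kernel
        smooth_kernel.inverse[OF csmooth_imp_smooth_kernel], of f g 1]]) (auto simp: divide_inverse)

lemma csmooth_cnj: "csmooth f \<Longrightarrow> csmooth (\<lambda>t. cnj (f t))"
  by (rule smooth_kernel_imp_csmooth[OF smooth_kernel.cnj[OF csmooth_imp_smooth_kernel, of f 1]]) auto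

text \<open>The points of the Heisenberg group are the null lines spanned by
  \<open>(1, z, w)\<close> with \<open>w = |z|\<^sup>2 + 4iu\<close>, for the Hermitian form
  \<open>herm (a, b, c) (a', b', c') = cnj a c' + cnj c a' - 2 cnj b b'\<close>; the line of \<open>(0, 0, 1)\<close> is the
  point at infinity.\<close>

definition wcoord :: "heis \<Rightarrow> complex" where
  "wcoord p = of_real ((cmod (fst p))^2) + 4 * \<i> * of_real (snd p)"

definition polar :: "heis \<Rightarrow> heis \<Rightarrow> complex" where
  "polar p q = wcoord q + cnj (wcoord p) - 2 * cnj (fst p) * fst q"

lemma Im_wcoord: "Im (wcoord p) = 4 * snd p"
  by (simp add: wcoord_def)

lemma wcoord_eq: "wcoord p = fst p * cnj (fst p) + 4 * \<i> * of_real (snd p)"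
  by (simp add: wcoord_def complex_norm_square[symmetric])

text \<open>\<open>polar p q\<close> is the \<open>wcoord\<close> of the group element p^(-1) q, and
  the squared modulus of a \<open>wcoord\<close> is the radicand |z|^4 + 16 u^2 of the Koranyi
  norm.\<close>

lemma koranyi_dist_eq: "koranyi_dist p q = sqrt (cmod (polar p q))"
proof -
  define h where "h = heis_mult (heis_inv p) q"
  have "polar p q = of_real ((cmod (fst h))^2) + 4 * \<i> * of_real (snd h)"
    by (rule complex_eqI; simp add: h_def polar_def wcoord_def heis_mult_def heis_inv_def cmod_power2;
        simp add: power2_eq_square algebra_simps add_divide_distrib diff_divide_distrib)
  moreover have "(cmod (of_real a + 4 * \<i> * of_real b))^2 = a^2 + 16 * b^2" for a b
    by (simp add: cmod_power2 power_mult_distrib)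
  ultimately have "(cmod (polar p q))^2 = ((cmod (fst h))^2)^2 + 16 * (snd h)^2"
    by (simp only:)
  then have "(cmod (polar p q))^2 = (cmod (fst h))^4 + 16 * (snd h)^2"
    by (simp flip: power_mult)
  then have "koranyi_dist p q = root 4 ((cmod (polar p q))^2)"
    by (simp add: koranyi_dist_def koranyi_norm_def h_def)
  also have "\<dots> = root (2 * 2) ((cmod (polar p q))^2)" by simp
  also have "\<dots> = sqrt (cmod (polar p q))"
    unfolding real_root_mult_exp sqrt_def by (simp add: real_root_power_cancel)
  finally show ?thesis .
qed

lemma koranyi_dist_eq_0_iff: "koranyi_dist p q = 0 \<longleftrightarrow> p = q"
proof
  assume "koranyi_dist p q = 0"
  then have "(cmod (fst q - fst p))^4 + 16 * (snd (heis_mult (heis_inv p) q))^2 = 0"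
    by (simp add: koranyi_dist_def koranyi_norm_def heis_mult_def heis_inv_def)
  then have "(cmod (fst q - fst p))^4 = 0 \<and> 16 * (snd (heis_mult (heis_inv p) q))^2 = 0"
    by (subst (asm) add_nonneg_eq_0_iff) auto
  then have "fst p = fst q" "snd (heis_mult (heis_inv p) q) = 0" by auto
  then show "p = q" by (auto simp: heis_mult_def heis_inv_def prod_eq_iff)
next
  assume "p = q"
  then show "koranyi_dist p q = 0"
    by (simp add: koranyi_dist_def koranyi_norm_def heis_mult_def heis_inv_def)
qed

text \<open>Since Re w = |z|^2 and Im w = 4u, horizontality becomes w' = 2 cnj(z) z'. Equivalently,
  the lift (1, z, w) is orthogonal to its derivative (0, z', w') for \<open>herm\<close>, a
  condition that form-preserving linear maps respect.\<close>

lemma legendrian_knotD: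
  assumes "legendrian_knot \<gamma> L"
  obtains z' where "csmooth (\<lambda>t. fst (\<gamma> t))" "csmooth (\<lambda>t. wcoord (\<gamma> t))" "csmooth z'"
    "\<And>t. ((\<lambda>t. fst (\<gamma> t)) has_vector_derivative z' t) (at t)"
    "\<And>t. ((\<lambda>t. wcoord (\<gamma> t)) has_vector_derivative 2 * cnj (fst (\<gamma> t)) * z' t) (at t)"
    "\<And>t. z' t \<noteq> 0" "\<And>t. hspeed \<gamma> t = cmod (z' t)"
proof -
  obtain D :: "nat \<Rightarrow> real \<Rightarrow> heis" where D: "D 0 = \<gamma>" "\<And>n t. (D n has_vector_derivative D (Suc n) t) (at t)"
    using assms unfolding legendrian_knot_def smooth_curve_def by blast
  have fst_D: "((\<lambda>t. fst (D n t)) has_vector_derivative fst (D (Suc n) t)) (at t)" for n t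
    by (rule bounded_linear.has_vector_derivative[OF bounded_linear_fst D(2)])
  have snd_D: "((\<lambda>t. complex_of_real (snd (D n t))) has_vector_derivative of_real (snd (D (Suc n) t))) (at t)" for n t
    by (rule bounded_linear.has_vector_derivative[OF bounded_linear_compose[OF bounded_linear_of_real bounded_linear_snd] D(2), unfolded o_def])
  have z: "csmooth (\<lambda>t. fst (\<gamma> t))" "csmooth (\<lambda>t. fst (D 1 t))" "csmooth (\<lambda>t. complex_of_real (snd (\<gamma> t)))"
    unfolding csmooth_def
  proof -
    show "\<exists>E. E 0 = (\<lambda>t. fst (\<gamma> t)) \<and> (\<forall>n t. (E n has_vector_derivative E (Suc n) t) (at t))"
      by (rule exI[of _ "\<lambda>n t. fst (D n t)"]) (use D(1) fst_D in auto)
    show "\<exists>E. E 0 = (\<lambda>t. fst (D 1 t)) \<and> (\<forall>n t. (E n has_vector_derivative E (Suc n) t) (at t))"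
      by (rule exI[of _ "\<lambda>n t. fst (D (Suc n) t)"]) (use fst_D in auto)
    show "\<exists>E. E 0 = (\<lambda>t. complex_of_real (snd (\<gamma> t))) \<and> (\<forall>n t. (E n has_vector_derivative E (Suc n) t) (at t))"
      by (rule exI[of _ "\<lambda>n t. complex_of_real (snd (D n t))"]) (use D(1) snd_D in auto)
  qed
  then have w: "csmooth (\<lambda>t. wcoord (\<gamma> t))"
    unfolding wcoord_eq by (intro csmooth_add csmooth_mult csmooth_cnj csmooth_const)
  have vd: "vector_derivative \<gamma> (at t) = D 1 t" for t
    using D(2)[of 0 t] D(1) by (simp add: vector_derivative_at)
  have nz: "fst (D 1 t) \<noteq> 0" and leg: "snd (D 1 t) = 1/2 * Im (cnj (fst (\<gamma> t)) * fst (D 1 t))" for t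
    using assms unfolding legendrian_knot_def vd by auto
  have der_z: "((\<lambda>t. fst (\<gamma> t)) has_vector_derivative fst (D 1 t)) (at t)" for t
    using fst_D[of 0 t] D(1) by simp
  have der_u: "((\<lambda>t. complex_of_real (snd (\<gamma> t))) has_vector_derivative of_real (snd (D 1 t))) (at t)" for t
    using snd_D[of 0 t] D(1) by simp
  have "((\<lambda>t. wcoord (\<gamma> t)) has_vector_derivative 2 * cnj (fst (\<gamma> t)) * fst (D 1 t)) (at t)" for t
  proof -
    have "((\<lambda>t. wcoord (\<gamma> t)) has_vector_derivative
        (fst (\<gamma> t) * cnj (fst (D 1 t)) + fst (D 1 t) * cnj (fst (\<gamma> t))) + 4 * \<i> * of_real (snd (D 1 t))) (at t)"
      unfolding wcoord_eq
      by (intro has_vector_derivative_add has_vector_derivative_mult has_vector_derivative_mult_right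
          has_vector_derivative_cnj der_z der_u)
    moreover have "(fst (\<gamma> t) * cnj (fst (D 1 t)) + fst (D 1 t) * cnj (fst (\<gamma> t))) + 4 * \<i> * of_real (snd (D 1 t))
        = 2 * cnj (fst (\<gamma> t)) * fst (D 1 t)"
      unfolding leg by (rule complex_eqI) (simp_all add: algebra_simps)
    ultimately show ?thesis by (simp only:)
  qed
  with z w nz der_z that[of "\<lambda>t. fst (D 1 t)"] show ?thesis
    by (simp add: hspeed_def vd)
qed

text \<open>The converse passage: u = Im w / 4 recovers the vertical coordinate and its
  derivatives.\<close>

lemma legendrian_knotI:
  fixes \<gamma> :: "real \<Rightarrow> heis"
  assumes L: "0 < L" and per: "\<And>t. \<gamma> (t + L) = \<gamma> t" and inj: "inj_on \<gamma> {0..<L}"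
    and smooth: "csmooth (\<lambda>t. fst (\<gamma> t))" "csmooth (\<lambda>t. wcoord (\<gamma> t))"
    and der_z: "\<And>t. ((\<lambda>t. fst (\<gamma> t)) has_vector_derivative z' t) (at t)"
    and der_w: "\<And>t. ((\<lambda>t. wcoord (\<gamma> t)) has_vector_derivative 2 * cnj (fst (\<gamma> t)) * z' t) (at t)"
    and nz: "\<And>t. z' t \<noteq> 0"
  shows "legendrian_knot \<gamma> L" and "hspeed \<gamma> t = cmod (z' t)"
proof -
  have u_eq: "snd (\<gamma> t) = Im (wcoord (\<gamma> t)) / 4" for t by (simp add: Im_wcoord)
  have der_u: "((\<lambda>t. snd (\<gamma> t)) has_vector_derivative Im (2 * cnj (fst (\<gamma> t)) * z' t) / 4) (at t)" for t
    unfolding u_eq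
    by (intro bounded_linear.has_vector_derivative[OF bounded_linear_compose[OF bounded_linear_divide bounded_linear_Im] der_w, unfolded o_def])
  have "((\<lambda>t. (fst (\<gamma> t), snd (\<gamma> t))) has_vector_derivative (z' t, Im (2 * cnj (fst (\<gamma> t)) * z' t) / 4)) (at t)" for t
    by (intro has_vector_derivative_Pair der_z der_u)
  then have vd: "vector_derivative \<gamma> (at t) = (z' t, Im (2 * cnj (fst (\<gamma> t)) * z' t) / 4)" for t
    by (simp add: vector_derivative_at)
  obtain Dz where Dz: "Dz 0 = (\<lambda>t. fst (\<gamma> t))" "\<And>n t. (Dz n has_vector_derivative Dz (Suc n) t) (at t)"
    using smooth(1) unfolding csmooth_def by blast
  obtain Dw where Dw: "Dw 0 = (\<lambda>t. wcoord (\<gamma> t))" "\<And>n t. (Dw n has_vector_derivative Dw (Suc n) t) (at t)"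
    using smooth(2) unfolding csmooth_def by blast
  have "smooth_curve \<gamma>"
    unfolding smooth_curve_def
  proof (intro exI[of _ "\<lambda>n t. (Dz n t, Im (Dw n t) / 4)"] conjI allI)
    show "(\<lambda>t. (Dz 0 t, Im (Dw 0 t) / 4)) = \<gamma>" by (simp add: Dz(1) Dw(1) flip: u_eq)
    fix n t
    show "((\<lambda>t. (Dz n t, Im (Dw n t) / 4)) has_vector_derivative (Dz (Suc n) t, Im (Dw (Suc n) t) / 4)) (at t)"
      by (intro has_vector_derivative_Pair Dz
          bounded_linear.has_vector_derivative[OF bounded_linear_compose[OF bounded_linear_divide bounded_linear_Im] Dw(2), unfolded o_def])
  qed
  then show "legendrian_knot \<gamma> L"
    unfolding legendrian_knot_def vd using L per inj nz by simp
  show "hspeed \<gamma> t = cmod (z' t)" by (simp add: hspeed_def vd)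
qed

lemma periodic_shift_int:
  fixes \<gamma> :: "real \<Rightarrow> 'a"
  assumes "\<And>t. \<gamma> (t + L) = \<gamma> t"
  shows "\<gamma> (t + of_int n * L) = \<gamma> t"
proof (induction n rule: int_induct[where k=0])
  case (step1 i)
  then show ?case using assms[of "t + of_int i * L"] by (simp add: algebra_simps)
next
  case (step2 i)
  then show ?case using assms[of "t + of_int (i - 1) * L"] by (simp add: algebra_simps)
qed simp

text \<open>Reducing both parameters to [0, L) shows that a coincidence forces r to be an integer
  multiple of L.\<close>

lemma legendrian_knot_injective:
  assumes "legendrian_knot \<gamma> L" "0 < \<bar>r\<bar>" "\<bar>r\<bar> < L"
  shows "\<gamma> s \<noteq> \<gamma> (s + r)"
proof
  assume eq: "\<gamma> s = \<gamma> (s + r)"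
  from assms(1) have L: "0 < L" and per: "\<And>t. \<gamma> (t + L) = \<gamma> t" and inj: "inj_on \<gamma> {0..<L}"
    by (auto simp: legendrian_knot_def)
  define red where "red t = t + of_int (- \<lfloor>t / L\<rfloor>) * L" for t
  have "red t \<in> {0..<L}" for t
  proof -
    have "of_int \<lfloor>t / L\<rfloor> * L \<le> t / L * L" "t / L * L < (of_int \<lfloor>t / L\<rfloor> + 1) * L"
      using L by (intro mult_right_mono mult_strict_right_mono; linarith)+
    then show ?thesis using L by (simp add: red_def algebra_simps)
  qed
  moreover have "\<gamma> (red t) = \<gamma> t" for t
    unfolding red_def using per by (rule periodic_shift_int)
  ultimately have "red s = red (s + r)" using inj eq by (metis inj_onD)
  then have "r = of_int (\<lfloor>(s + r) / L\<rfloor> - \<lfloor>s / L\<rfloor>) * L" by (simp add: red_def algebra_simps)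
  moreover define n where "n = \<lfloor>(s + r) / L\<rfloor> - \<lfloor>s / L\<rfloor>"
  ultimately have r: "r = of_int n * L" by simp
  then have "n \<noteq> 0" using assms(2) by auto
  then have "1 * L \<le> \<bar>of_int n\<bar> * L" using L by (intro mult_right_mono) auto
  then show False using assms(3) r L by (simp add: abs_mult)
qed

text \<open>Horizontality makes the r-derivative of \<open>polar\<close> equal to 2 cnj(z(s + r) -
  z(s)) z'(s + r), which is itself divisible by r. Two Hadamard quotients then split off r^2 with a
  smooth cofactor. The cofactor is |z'(s)|^2 at r = 0, and off the diagonal it is nonzero by
  injectivity of the knot.\<close>

lemma legendrian_knot_polar:
  assumes "legendrian_knot \<gamma> L"
  obtains Q where "smooth_kernel L (\<lambda>\<zeta>. Q)" "\<And>s r. \<bar>r\<bar> < L \<Longrightarrow> Q s r \<noteq> 0"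
    "\<And>s r. \<bar>r\<bar> < L \<Longrightarrow> polar (\<gamma> s) (\<gamma> (s + r)) = of_real (r^2) * Q s r"
proof -
  obtain z' where z': "csmooth z'" "\<And>t. ((\<lambda>t. fst (\<gamma> t)) has_vector_derivative z' t) (at t)"
    "\<And>t. ((\<lambda>t. wcoord (\<gamma> t)) has_vector_derivative 2 * cnj (fst (\<gamma> t)) * z' t) (at t)" "\<And>t. z' t \<noteq> 0"
    by (rule legendrian_knotD[OF assms]) blast
  note kz' = csmooth_imp_smooth_kernel[OF z'(1), of L]
  define Z where "Z = (\<lambda>s r. integral {0..1} (\<lambda>\<theta>. of_real \<theta> ^ 0 * z' (s + \<theta> * r)))"
  define K where "K = (\<lambda>s r. 2 * cnj (Z s r) * z' (s + r))"
  \<comment> \<open>At \<theta> r the derivative of \<open>polar\<close> is \<theta> r K(s, \<theta>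
    r): the factor r is pulled out and \<theta> stays, whence the exponent 1.\<close>
  define Q where "Q = (\<lambda>s r. integral {0..1} (\<lambda>\<theta>. of_real \<theta> ^ 1 * K s (\<theta> * r)))"
  have Z: "smooth_kernel L (\<lambda>\<zeta>. Z)" unfolding Z_def by (rule smooth_kernel.average[OF kz'])
  then have K: "smooth_kernel L (\<lambda>\<zeta>. K)" unfolding K_def
    by (intro smooth_kernel.mult smooth_kernel.cnj smooth_kernel_const kz')
  have Q: "smooth_kernel L (\<lambda>\<zeta>. Q)" unfolding Q_def by (rule smooth_kernel.average[OF K])
  have chord: "fst (\<gamma> (s + r)) - fst (\<gamma> s) = of_real r * Z s r" for s r
  proof -
    have "((\<lambda>r. fst (\<gamma> (s + r))) has_vector_derivative z' (s + x)) (at x)" for x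
      using z'(2)[of "s + x"] has_vector_derivative_translate[of "\<lambda>t. fst (\<gamma> t)"] by blast
    from hadamard_quotient[of "\<bar>r\<bar> + 1" "\<lambda>r. fst (\<gamma> (s + r))" "\<lambda>x. z' (s + x)" r, OF this]
    show ?thesis by (simp add: Z_def)
  qed
  have polar_eq: "polar (\<gamma> s) (\<gamma> (s + r)) = of_real (r^2) * Q s r" for s r
  proof -
    have der: "((\<lambda>r. polar (\<gamma> s) (\<gamma> (s + r))) has_vector_derivative of_real x * K s x) (at x)" for x
    proof -
      have "((\<lambda>r. wcoord (\<gamma> (s + r))) has_vector_derivative 2 * cnj (fst (\<gamma> (s + x))) * z' (s + x)) (at x)"
        using z'(3)[of "s + x"] has_vector_derivative_translate[of "\<lambda>t. wcoord (\<gamma> t)"] by blast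
      moreover have "((\<lambda>r. fst (\<gamma> (s + r))) has_vector_derivative z' (s + x)) (at x)"
        using z'(2)[of "s + x"] has_vector_derivative_translate[of "\<lambda>t. fst (\<gamma> t)"] by blast
      ultimately have "((\<lambda>r. wcoord (\<gamma> (s + r)) + cnj (wcoord (\<gamma> s)) - 2 * cnj (fst (\<gamma> s)) * fst (\<gamma> (s + r)))
          has_vector_derivative 2 * cnj (fst (\<gamma> (s + x))) * z' (s + x) + 0 - 2 * cnj (fst (\<gamma> s)) * z' (s + x)) (at x)"
        by (intro has_vector_derivative_add has_vector_derivative_diff has_vector_derivative_const
            has_vector_derivative_mult_right)
      moreover have "2 * cnj (fst (\<gamma> (s + x))) * z' (s + x) + 0 - 2 * cnj (fst (\<gamma> s)) * z' (s + x) =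
          2 * cnj (fst (\<gamma> (s + x)) - fst (\<gamma> s)) * z' (s + x)" by (simp add: algebra_simps)
      moreover have "\<dots> = of_real x * K s x"
        unfolding chord[of s x] by (simp add: K_def)
      ultimately show ?thesis unfolding polar_def by simp
    qed
    \<comment> \<open>The lift is a null vector: Re w = |z|^2.\<close>
    have "polar (\<gamma> s) (\<gamma> (s + 0)) = 0"
      by (simp add: polar_def wcoord_def complex_eq_iff cmod_power2) (simp add: power2_eq_square)
    with hadamard_quotient[of "\<bar>r\<bar> + 1" "\<lambda>r. polar (\<gamma> s) (\<gamma> (s + r))", OF der, of r]
    have "polar (\<gamma> s) (\<gamma> (s + r)) =
        of_real r * integral {0..1} (\<lambda>\<theta>. of_real r * (of_real \<theta> ^ 1 * K s (\<theta> * r)))"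
      by (simp add: ac_simps)
    then show ?thesis unfolding integral_mult_right Q_def by (simp add: power2_eq_square)
  qed
  have "Q s r \<noteq> 0" if "\<bar>r\<bar> < L" for s r
  proof (cases "r = 0")
    case True
    \<comment> \<open>At r = 0 the average of \<theta> c over [0, 1] is c/2, the squared
      speed.\<close>
    define c where "c = 2 * (cnj (z' s) * z' s)"
    have "((\<lambda>x. of_real x ^ 2 / 2 * c) has_vector_derivative of_real x * c) (at x within {0..1})" for x
      by (rule has_vector_derivative_real_field[where f="\<lambda>x. x^2 / 2 * c"])
         (auto intro!: derivative_eq_intros)
    then have "((\<lambda>\<theta>. of_real \<theta> * c) has_integral of_real 1 ^ 2 / 2 * c - of_real 0 ^ 2 / 2 * c) {0..1}"
      by (intro fundamental_theorem_of_calculus) auto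
    moreover have "Q s 0 = integral {0..1} (\<lambda>\<theta>. of_real \<theta> * c)"
      by (simp add: Q_def K_def Z_def c_def mult.assoc)
    ultimately have "Q s 0 = cnj (z' s) * z' s"
      by (simp only: integral_unique) (simp add: c_def)
    then show ?thesis using True z'(4)[of s] by simp
  next
    case False
    then have "koranyi_dist (\<gamma> s) (\<gamma> (s + r)) \<noteq> 0"
      using legendrian_knot_injective[OF assms _ that, of s] by (simp add: koranyi_dist_eq_0_iff)
    then show ?thesis unfolding koranyi_dist_eq polar_eq[of s r] by auto
  qed
  with Q polar_eq that show ?thesis by blast
qed

text \<open>The modulus is not holomorphic, so it enters the class through |x|^2 = x cnj(x), which
  for x \<noteq> 0 is a positive real and avoids the branch cut of \<open>Ln\<close>.\<close>

proposition legendrian_knot_kernel: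
  assumes "legendrian_knot \<gamma> L"
  obtains g where "smooth_kernel L g"
    "\<And>\<zeta> s r. 0 < \<bar>r\<bar> \<Longrightarrow> \<bar>r\<bar> < L \<Longrightarrow>
      of_real (koranyi_dist (\<gamma> s) (\<gamma> (s + r))) powr \<zeta> * of_real (hspeed \<gamma> s * hspeed \<gamma> (s + r)) =
      of_real \<bar>r\<bar> powr \<zeta> * g \<zeta> s r"
proof -
  obtain Q where Q: "smooth_kernel L (\<lambda>\<zeta>. Q)" "\<And>s r. \<bar>r\<bar> < L \<Longrightarrow> Q s r \<noteq> 0"
    "\<And>s r. \<bar>r\<bar> < L \<Longrightarrow> polar (\<gamma> s) (\<gamma> (s + r)) = of_real (r^2) * Q s r"
    by (rule legendrian_knot_polar[OF assms]) blast
  obtain z' where z': "csmooth z'" "\<And>t. z' t \<noteq> 0" "\<And>t. hspeed \<gamma> t = cmod (z' t)"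
    by (rule legendrian_knotD[OF assms]) blast
  have sq_notin: "x * cnj x \<notin> \<real>\<^sub>\<le>\<^sub>0" if "x \<noteq> 0" for x :: complex
    using that by (simp add: complex_norm_square[symmetric] complex_nonpos_Reals_iff flip: of_real_power)
  have Ln_sq: "Ln (x * cnj x) = of_real (2 * ln (cmod x))" if "x \<noteq> 0" for x :: complex
    using that by (simp add: complex_norm_square[symmetric] Ln_of_real ln_realpow flip: of_real_power)
  have exp_Ln_sq: "exp (Ln (x * cnj x) / 2) = of_real (cmod x)" if "x \<noteq> 0" for x :: complex
    using that by (simp add: Ln_sq exp_of_real)
  \<comment> \<open>The distance divided by |r| is |Q|^(1/2) = (Q cnj(Q))^(1/4), and the speed at s
    + r is (z' cnj(z'))^(1/2); these are the exponents 1/4 and 1/2. The speed at s depends on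
    neither \<zeta> nor r and enters as a continuous parameter.\<close>
  define g where "g = (\<lambda>\<zeta> s r. exp (\<zeta> * (1/4 * Ln (Q s r * cnj (Q s r)))) *
      (of_real (cmod (z' s)) * exp (1/2 * Ln (z' (s + r) * cnj (z' (s + r))))))"
  have "smooth_kernel L (\<lambda>\<zeta> s r. of_real (cmod (z' s)))"
    by (rule smooth_kernel.param[where f="\<lambda>\<zeta> s. of_real (cmod (z' s))"])
       (auto simp: split_beta intro!: continuous_intros continuous_on_compose2[OF csmooth_continuous[OF z'(1), of UNIV]])
  then have "smooth_kernel L g"
    unfolding g_def
    by (intro smooth_kernel.exp smooth_kernel.mult smooth_kernel.Ln smooth_kernel_const smooth_kernel_zeta
        Q(1) smooth_kernel.cnj[OF Q(1)] csmooth_imp_smooth_kernel csmooth_cnj z'(1) sq_notin Q(2) z'(2))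
  moreover have "of_real (koranyi_dist (\<gamma> s) (\<gamma> (s + r))) powr \<zeta> * of_real (hspeed \<gamma> s * hspeed \<gamma> (s + r)) =
      of_real \<bar>r\<bar> powr \<zeta> * g \<zeta> s r" if r: "0 < \<bar>r\<bar>" "\<bar>r\<bar> < L" for \<zeta> s r
  proof -
    define q where "q = sqrt (cmod (Q s r))"
    have q: "0 < q" "cmod (Q s r) = q^2" using Q(2)[OF r(2), of s] by (simp_all add: q_def)
    have "koranyi_dist (\<gamma> s) (\<gamma> (s + r)) = \<bar>r\<bar> * q"
      by (simp add: koranyi_dist_eq Q(3)[OF r(2)] norm_mult real_sqrt_mult q_def norm_power)
    then have "of_real (koranyi_dist (\<gamma> s) (\<gamma> (s + r))) powr \<zeta> = of_real \<bar>r\<bar> powr \<zeta> * complex_of_real q powr \<zeta>"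
      using q(1) by (simp only: of_real_mult) (rule powr_times_real; simp)
    moreover have "complex_of_real q powr \<zeta> = exp (\<zeta> * (1/4 * Ln (Q s r * cnj (Q s r))))"
      using q Q(2)[OF r(2), of s] by (simp add: Ln_sq powr_def Ln_of_real ln_realpow)
    ultimately show ?thesis
      by (simp add: g_def z'(3) exp_Ln_sq[OF z'(2)])
  qed
  ultimately show ?thesis using that by blast
qed

section \<open>The action of PU(2,1) on Legendrian knots\<close>

definition herm :: "complex \<Rightarrow> complex \<Rightarrow> complex \<Rightarrow> complex \<Rightarrow> complex \<Rightarrow> complex \<Rightarrow> complex" where
  "herm a b c a' b' c' = cnj a * c' + cnj c * a' - 2 * cnj b * b'"

lemma polar_eq_herm: "polar p q = herm 1 (fst p) (wcoord p) 1 (fst q) (wcoord q)"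
  by (simp add: polar_def herm_def)

definition linear_form :: "(complex \<Rightarrow> complex \<Rightarrow> complex \<Rightarrow> complex) \<Rightarrow> bool" where
  "linear_form A \<longleftrightarrow> (\<exists>a b c. \<forall>x y w. A x y w = a * x + b * y + c * w)"

lemma linear_form_add: "linear_form A \<Longrightarrow> linear_form B \<Longrightarrow> linear_form (\<lambda>x y w. A x y w + B x y w)"
proof -
  assume "linear_form A" "linear_form B"
  then obtain a b c a' b' c' where
    "\<And>x y w. A x y w = a * x + b * y + c * w" "\<And>x y w. B x y w = a' * x + b' * y + c' * w"
    unfolding linear_form_def by metis
  then show ?thesis unfolding linear_form_def
    by (intro exI[of _ "a + a'"] exI[of _ "b + b'"] exI[of _ "c + c'"]) (simp add: algebra_simps)
qed

lemma linear_form_mult: "linear_form A \<Longrightarrow> linear_form (\<lambda>x y w. k * A x y w)"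
proof -
  assume "linear_form A"
  then obtain a b c where "\<And>x y w. A x y w = a * x + b * y + c * w"
    unfolding linear_form_def by metis
  then show ?thesis unfolding linear_form_def
    by (intro exI[of _ "k * a"] exI[of _ "k * b"] exI[of _ "k * c"]) (simp add: algebra_simps)
qed

text \<open>The nonzero vectors of the null line of P. For a finite point the scale \<open>a\<close>
  is arbitrary; this freedom becomes the factor \<alpha> by which an image lift differs from the
  normalised one.\<close>

definition on_line :: "heis option \<Rightarrow> complex \<Rightarrow> complex \<Rightarrow> complex \<Rightarrow> bool" where
  "on_line P a b c \<longleftrightarrow> (case P of
      None \<Rightarrow> a = 0 \<and> b = 0 \<and> c \<noteq> 0
    | Some q \<Rightarrow> a \<noteq> 0 \<and> b = a * fst q \<and> c = a * wcoord q)"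

definition unitary_lift :: "(heis option \<Rightarrow> heis option) \<Rightarrow> (complex \<Rightarrow> complex \<Rightarrow> complex \<Rightarrow> complex) \<Rightarrow>
    (complex \<Rightarrow> complex \<Rightarrow> complex \<Rightarrow> complex) \<Rightarrow> (complex \<Rightarrow> complex \<Rightarrow> complex \<Rightarrow> complex) \<Rightarrow> bool" where
  "unitary_lift T A B C \<longleftrightarrow> linear_form A \<and> linear_form B \<and> linear_form C \<and>
    (\<forall>a b c a' b' c'. herm (A a b c) (B a b c) (C a b c) (A a' b' c') (B a' b' c') (C a' b' c') =
      herm a b c a' b' c') \<and>
    (\<forall>P a b c. on_line P a b c \<longrightarrow> on_line (T P) (A a b c) (B a b c) (C a b c))"

lemma linear_form_compose:
  assumes "linear_form F" "linear_form A" "linear_form B" "linear_form C"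
  shows "linear_form (\<lambda>x y w. F (A x y w) (B x y w) (C x y w))"
proof -
  obtain a b c where "\<And>x y w. F x y w = a * x + b * y + c * w"
    using assms(1) unfolding linear_form_def by metis
  then show ?thesis using assms by (simp add: linear_form_add linear_form_mult)
qed

lemma linear_form_coords [simp]:
  "linear_form (\<lambda>x y w. x)" "linear_form (\<lambda>x y w. y)" "linear_form (\<lambda>x y w. w)"
  unfolding linear_form_def
  by (rule exI[of _ 1], rule exI[of _ 0], rule exI[of _ 0], simp)
     (rule exI[of _ 0], rule exI[of _ 1], rule exI[of _ 0], simp,
      rule exI[of _ 0], rule exI[of _ 0], rule exI[of _ 1], simp)

lemma unitary_lift_compose:
  assumes "unitary_lift S F G H" "unitary_lift T A B C"
  shows "unitary_lift (S \<circ> T) (\<lambda>x y w. F (A x y w) (B x y w) (C x y w))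
    (\<lambda>x y w. G (A x y w) (B x y w) (C x y w)) (\<lambda>x y w. H (A x y w) (B x y w) (C x y w))"
  using assms unfolding unitary_lift_def by (simp add: linear_form_compose)

lemma wcoord_eq_0_iff: "wcoord (z, u) = 0 \<longleftrightarrow> z = 0 \<and> u = 0"
  by (auto simp: wcoord_def complex_eq_iff)

text \<open>Since |z|^4 + 16 u^2 = |w|^2, the inversion is (z, w) \<mapsto> (z/w, 1/w), and 1/w =
  cnj(w) / |w|^2 has the required real part |z/w|^2. At w = 0 both sides are 0 by the convention for
  division.\<close>

lemma wcoord_inversion:
  "wcoord (z / wcoord (z, u), - u / ((cmod z)^4 + 16 * u^2)) = inverse (wcoord (z, u))"
proof -
  have n: "(cmod (wcoord (z, u)))^2 = (cmod z)^4 + 16 * u^2"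
  proof -
    have "(cmod (of_real a + 4 * \<i> * of_real b))^2 = a^2 + 16 * b^2" for a b
      by (simp add: cmod_power2 power_mult_distrib)
    from this[of "(cmod z)^2" u] show ?thesis by (simp add: wcoord_def flip: power_mult)
  qed
  have "wcoord (z / wcoord (z, u), - u / ((cmod z)^4 + 16 * u^2)) =
      of_real ((cmod z)^2 / (cmod (wcoord (z, u)))^2) - 4 * \<i> * of_real (u / (cmod (wcoord (z, u)))^2)"
    unfolding n[symmetric] by (simp add: wcoord_def[of "(z / _, _)"] norm_divide power_divide)
  also have "\<dots> = cnj (wcoord (z, u)) / of_real ((cmod (wcoord (z, u)))^2)"
    by (simp add: wcoord_def[of "(z, u)"] diff_divide_distrib)
  also have "\<dots> = inverse (wcoord (z, u))"
    unfolding complex_norm_square by (cases "wcoord (z, u) = 0") (simp_all add: divide_inverse)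
  finally show ?thesis .
qed

text \<open>The group law is affine in the coordinates z and w of \<open>q\<close>; this formula is
  the last row of the matrix of a translation.\<close>

lemma wcoord_mult: "wcoord (heis_mult p q) = wcoord q + wcoord p + 2 * cnj (fst p) * fst q"
  by (rule complex_eqI; simp add: wcoord_def heis_mult_def cmod_power2;
      simp add: power2_eq_square algebra_simps add_divide_distrib diff_divide_distrib)

text \<open>The vector (1, l z, l^2 w) is divided by l: the weights 1/l and l of the outer
  coordinates then cancel in \<open>herm\<close>.\<close>

lemma unitary_lift_dilation:
  assumes "0 < l"
  shows "unitary_lift (heis_dilation l) (\<lambda>a b c. inverse (of_real l) * a) (\<lambda>a b c. b) (\<lambda>a b c. of_real l * c)"
proof -
  have "wcoord (of_real l * z, l^2 * u) = of_real l * (of_real l * wcoord (z, u))" for z u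
    by (simp add: wcoord_def norm_mult power_mult_distrib) (simp add: power2_eq_square algebra_simps)
  moreover have "herm (inverse (of_real l) * a) b (of_real l * c) (inverse (of_real l) * a') b' (of_real l * c') =
      herm a b c a' b' c'" for a b c a' b' c'
    using assms by (simp add: herm_def field_simps)
  ultimately show ?thesis
    using assms unfolding unitary_lift_def on_line_def
    by (auto simp: linear_form_mult heis_dilation_def split: option.splits)
qed

text \<open>The form is preserved because the lift of \<open>p\<close> is null, that is,
  \<open>wcoord p + cnj (wcoord p)\<close> equals twice the squared modulus of
  \<open>fst p\<close>.\<close>

lemma unitary_lift_translation:
  "unitary_lift (heis_translation p) (\<lambda>a b c. a) (\<lambda>a b c. b + fst p * a)
    (\<lambda>a b c. c + wcoord p * a + 2 * cnj (fst p) * b)"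
proof -
  have "wcoord p + cnj (wcoord p) = 2 * fst p * cnj (fst p)" by (simp add: wcoord_eq)
  then have w: "cnj (wcoord p) = 2 * fst p * cnj (fst p) - wcoord p" by (simp add: algebra_simps)
  have h: "herm a (b + fst p * a) (c + wcoord p * a + 2 * cnj (fst p) * b)
      a' (b' + fst p * a') (c' + wcoord p * a' + 2 * cnj (fst p) * b') = herm a b c a' b' c'" for a b c a' b' c'
    by (simp add: herm_def w algebra_simps)
  have "fst (heis_mult p q) = fst p + fst q" for q by (simp add: heis_mult_def)
  then have "on_line P a b c \<Longrightarrow> on_line (heis_translation p P) a (b + fst p * a)
      (c + wcoord p * a + 2 * cnj (fst p) * b)" for P a b c
    by (auto simp: on_line_def heis_translation_def wcoord_mult algebra_simps split: option.splits)
  then show ?thesis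
    unfolding unitary_lift_def by (simp add: linear_form_mult linear_form_add h)
qed

lemma unitary_lift_rotation:
  "unitary_lift (heis_rotation \<theta>) (\<lambda>a b c. a) (\<lambda>a b c. cis \<theta> * b) (\<lambda>a b c. c)"
proof -
  have "cnj (cis \<theta> * b) * (cis \<theta> * b') = (cnj (cis \<theta>) * cis \<theta>) * (cnj b * b')" for b b'
    by (simp add: algebra_simps)
  then have "cnj (cis \<theta> * b) * (cis \<theta> * b') = cnj b * b'" for b b'
    by (simp add: cis_cnj cis_mult)
  then have h: "herm a (cis \<theta> * b) c a' (cis \<theta> * b') c' = herm a b c a' b' c'" for a b c a' b' c'
    by (simp only: herm_def mult.assoc)
  show ?thesis
    unfolding unitary_lift_def on_line_def
    by (auto simp: linear_form_mult h heis_rotation_def wcoord_def norm_mult split: option.splits)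
qed

text \<open>Swapping the outer coordinates sends (1, z, w) to (w, z, 1) = w (1, z/w, 1/w) and
  exchanges the lines of the origin and of infinity; \<open>herm\<close> is symmetric under the
  swap.\<close>

lemma unitary_lift_inversion:
  "unitary_lift heis_inversion (\<lambda>a b c. c) (\<lambda>a b c. b) (\<lambda>a b c. a)"
proof -
  have h: "herm c b a c' b' a' = herm a b c a' b' c'" for a b c a' b' c'
    by (simp add: herm_def)
  have inv: "heis_inversion (Some (z, u)) = (if wcoord (z, u) = 0 then None
      else Some (z / wcoord (z, u), - u / ((cmod z)^4 + 16 * u^2)))" for z u
    using wcoord_eq_0_iff[of z u] by (auto simp: heis_inversion_def wcoord_def[of "(z, u)"])
  have "on_line (heis_inversion P) c b a" if "on_line P a b c" for P a b c
  proof (cases P)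
    case None
    then show ?thesis using that by (simp add: on_line_def heis_inversion_def wcoord_eq_0_iff)
  next
    case (Some q)
    obtain z u where q: "q = (z, u)" by fastforce
    show ?thesis
    proof (cases "wcoord (z, u) = 0")
      case True
      then show ?thesis using that by (simp add: on_line_def Some q inv) (simp add: wcoord_eq_0_iff)
    next
      case False
      then show ?thesis using that by (simp add: on_line_def Some q inv wcoord_inversion[simplified])
    qed
  qed
  then show ?thesis unfolding unitary_lift_def by (simp add: h)
qed

lemma PU21_unitary_lift: "T \<in> PU21 \<Longrightarrow> \<exists>A B C. unitary_lift T A B C"
proof (induction rule: PU21.induct)
  case PU21_id
  have "unitary_lift id (\<lambda>a b c. a) (\<lambda>a b c. b) (\<lambda>a b c. c)" by (simp add: unitary_lift_def)
  then show ?case by blast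
qed (use unitary_lift_compose unitary_lift_dilation unitary_lift_translation unitary_lift_rotation
      unitary_lift_inversion in blast)+

text \<open>The image of the lift (1, z, w) is \<alpha> times the normalised lift of the image
  point, and \<alpha> is nowhere 0 because the image is finite. Preservation of \<open>herm\<close>
  on two lifts gives the formula for \<open>polar\<close>, on a lift and its derivative the
  horizontality, and on the derivative with itself the speed.\<close>

proposition legendrian_knot_image:
  assumes K: "legendrian_knot \<gamma> L" and T: "T \<in> PU21" and fin: "\<And>t. T (Some (\<gamma> t)) \<noteq> None"
  obtains \<alpha> :: "real \<Rightarrow> complex" where "legendrian_knot (image_curve T \<gamma>) L" "\<And>t. \<alpha> t \<noteq> 0"
    "\<And>t. hspeed (image_curve T \<gamma>) t = hspeed \<gamma> t / cmod (\<alpha> t)"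
    "\<And>s t. polar (\<gamma> s) (\<gamma> t) = cnj (\<alpha> s) * \<alpha> t * polar (image_curve T \<gamma> s) (image_curve T \<gamma> t)"
proof -
  obtain A B C where N: "unitary_lift T A B C" using PU21_unitary_lift[OF T] by blast
  then have lin: "linear_form A" "linear_form B" "linear_form C"
    and iso: "\<And>x y w x' y' w'. herm (A x y w) (B x y w) (C x y w) (A x' y' w') (B x' y' w') (C x' y' w') =
      herm x y w x' y' w'"
    unfolding unitary_lift_def by blast+
  obtain z' where z': "csmooth (\<lambda>t. fst (\<gamma> t))" "csmooth (\<lambda>t. wcoord (\<gamma> t))"
    "\<And>t. ((\<lambda>t. fst (\<gamma> t)) has_vector_derivative z' t) (at t)"
    "\<And>t. ((\<lambda>t. wcoord (\<gamma> t)) has_vector_derivative 2 * cnj (fst (\<gamma> t)) * z' t) (at t)"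
    "\<And>t. z' t \<noteq> 0" "\<And>t. hspeed \<gamma> t = cmod (z' t)"
    by (rule legendrian_knotD[OF K]) blast
  define w' where "w' t = 2 * cnj (fst (\<gamma> t)) * z' t" for t
  have curve: "csmooth (\<lambda>t. F 1 (fst (\<gamma> t)) (wcoord (\<gamma> t)))"
    "((\<lambda>t. F 1 (fst (\<gamma> t)) (wcoord (\<gamma> t))) has_vector_derivative F 0 (z' t) (w' t)) (at t)"
    if F_lin: "linear_form F" for F t
  proof -
    obtain a b c where F: "\<And>x y w. F x y w = a * x + b * y + c * w"
      using F_lin unfolding linear_form_def by metis
    show "csmooth (\<lambda>t. F 1 (fst (\<gamma> t)) (wcoord (\<gamma> t)))"
      unfolding F by (intro csmooth_add csmooth_mult csmooth_const z')
    have "((\<lambda>t. a * 1 + b * fst (\<gamma> t) + c * wcoord (\<gamma> t)) has_vector_derivative 0 + b * z' t + c * w' t) (at t)"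
      unfolding w'_def
      by (intro has_vector_derivative_add has_vector_derivative_mult_right z' has_vector_derivative_const)
    then show "((\<lambda>t. F 1 (fst (\<gamma> t)) (wcoord (\<gamma> t))) has_vector_derivative F 0 (z' t) (w' t)) (at t)"
      unfolding F by simp
  qed
  define \<alpha> where "\<alpha> t = A 1 (fst (\<gamma> t)) (wcoord (\<gamma> t))" for t
  define \<beta> where "\<beta> t = B 1 (fst (\<gamma> t)) (wcoord (\<gamma> t))" for t
  define \<kappa> where "\<kappa> t = C 1 (fst (\<gamma> t)) (wcoord (\<gamma> t))" for t
  define \<alpha>' where "\<alpha>' t = A 0 (z' t) (w' t)" for t
  define \<beta>' where "\<beta>' t = B 0 (z' t) (w' t)" for t
  define \<kappa>' where "\<kappa>' t = C 0 (z' t) (w' t)" for t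
  define \<delta> where "\<delta> = image_curve T \<gamma>"
  have smooth: "csmooth \<alpha>" "csmooth \<beta>" "csmooth \<kappa>"
    using curve(1)[OF lin(1)] curve(1)[OF lin(2)] curve(1)[OF lin(3)]
    by (simp_all add: \<alpha>_def[abs_def] \<beta>_def[abs_def] \<kappa>_def[abs_def])
  have der: "(\<alpha> has_vector_derivative \<alpha>' t) (at t)" "(\<beta> has_vector_derivative \<beta>' t) (at t)"
    "(\<kappa> has_vector_derivative \<kappa>' t) (at t)" for t
    using curve(2)[OF lin(1)] curve(2)[OF lin(2)] curve(2)[OF lin(3)]
    by (simp_all add: \<alpha>_def[abs_def] \<beta>_def[abs_def] \<kappa>_def[abs_def] \<alpha>'_def \<beta>'_def \<kappa>'_def)
  have proj: "\<alpha> t \<noteq> 0 \<and> \<beta> t = \<alpha> t * fst (\<delta> t) \<and> \<kappa> t = \<alpha> t * wcoord (\<delta> t)" for t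
  proof -
    obtain q where q: "T (Some (\<gamma> t)) = Some q" using fin[of t] by blast
    have "on_line (Some (\<gamma> t)) 1 (fst (\<gamma> t)) (wcoord (\<gamma> t))" by (simp add: on_line_def)
    then have "on_line (T (Some (\<gamma> t))) (\<alpha> t) (\<beta> t) (\<kappa> t)"
      using N unfolding unitary_lift_def \<alpha>_def \<beta>_def \<kappa>_def by blast
    then show ?thesis by (simp add: q \<delta>_def image_curve_def on_line_def)
  qed
  then have nz: "\<alpha> t \<noteq> 0" and Z_eq: "fst (\<delta> t) = \<beta> t / \<alpha> t" and W_eq: "wcoord (\<delta> t) = \<kappa> t / \<alpha> t" for t
    by (auto simp: field_simps)
  have polar: "polar (\<gamma> s) (\<gamma> t) = cnj (\<alpha> s) * \<alpha> t * polar (\<delta> s) (\<delta> t)" for s t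
  proof -
    have "polar (\<gamma> s) (\<gamma> t) = herm (\<alpha> s) (\<beta> s) (\<kappa> s) (\<alpha> t) (\<beta> t) (\<kappa> t)"
      unfolding polar_eq_herm \<alpha>_def \<beta>_def \<kappa>_def iso ..
    also have "\<dots> = cnj (\<alpha> s) * \<alpha> t * polar (\<delta> s) (\<delta> t)"
      using proj[of s] proj[of t] by (simp add: polar_eq_herm herm_def algebra_simps)
    finally show ?thesis .
  qed
  define Z' where "Z' t = (\<beta>' t - \<alpha>' t * fst (\<delta> t)) / \<alpha> t" for t
  define W' where "W' t = (\<kappa>' t - \<alpha>' t * wcoord (\<delta> t)) / \<alpha> t" for t
  have quot: "((\<lambda>t. f t / \<alpha> t) has_vector_derivative (f' - \<alpha>' t * (f t / \<alpha> t)) / \<alpha> t) (at t)"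
    if "(f has_vector_derivative f') (at t)" for f f' t
  proof -
    have "((\<lambda>t. inverse (\<alpha> t)) has_vector_derivative \<alpha>' t * - (inverse (\<alpha> t) ^ Suc (Suc 0))) (at t)"
      using field_vector_diff_chain_at[OF der(1)[of t] DERIV_inverse[OF nz[of t]]] by (simp add: o_def)
    from has_vector_derivative_mult[OF that this]
    have "((\<lambda>t. f t / \<alpha> t) has_vector_derivative
        f t * (\<alpha>' t * - (inverse (\<alpha> t) ^ Suc (Suc 0))) + f' * inverse (\<alpha> t)) (at t)"
      by (simp add: divide_inverse)
    moreover have "f t * (\<alpha>' t * - (inverse (\<alpha> t) ^ Suc (Suc 0))) + f' * inverse (\<alpha> t) =
        (f' - \<alpha>' t * (f t / \<alpha> t)) / \<alpha> t"
      using nz[of t] by (simp add: field_simps)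
    ultimately show ?thesis by (simp only:)
  qed
  have der_Z: "((\<lambda>t. fst (\<delta> t)) has_vector_derivative Z' t) (at t)" for t
    using quot[OF der(2)[of t]] by (simp add: Z_eq Z'_def)
  have der_W: "((\<lambda>t. wcoord (\<delta> t)) has_vector_derivative W' t) (at t)" for t
    using quot[OF der(3)[of t]] by (simp add: W_eq W'_def)
  have null: "wcoord (\<delta> t) + cnj (wcoord (\<delta> t)) = 2 * fst (\<delta> t) * cnj (fst (\<delta> t))" for t
    by (simp add: wcoord_eq)
  have leg: "W' t = 2 * cnj (fst (\<delta> t)) * Z' t" for t
  proof -
    \<comment> \<open>Orthogonality of lift and derivative, transported by the isometry; cancelling
      cnj(\<alpha>) leaves the horizontality of the image.\<close>
    have "herm (\<alpha> t) (\<beta> t) (\<kappa> t) (\<alpha>' t) (\<beta>' t) (\<kappa>' t) = 0"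
      unfolding \<alpha>_def \<beta>_def \<kappa>_def \<alpha>'_def \<beta>'_def \<kappa>'_def iso by (simp add: herm_def w'_def)
    then have "cnj (\<alpha> t) * (\<kappa>' t + cnj (wcoord (\<delta> t)) * \<alpha>' t - 2 * cnj (fst (\<delta> t)) * \<beta>' t) = 0"
      using proj[of t] by (simp add: herm_def algebra_simps)
    then have "\<kappa>' t = 2 * cnj (fst (\<delta> t)) * \<beta>' t - cnj (wcoord (\<delta> t)) * \<alpha>' t"
      using nz[of t] by (simp only: mult_eq_0_iff complex_cnj_zero_iff) (simp add: algebra_simps)
    then have "\<kappa>' t - \<alpha>' t * wcoord (\<delta> t) =
        2 * cnj (fst (\<delta> t)) * \<beta>' t - (wcoord (\<delta> t) + cnj (wcoord (\<delta> t))) * \<alpha>' t"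
      by (simp add: algebra_simps)
    also have "\<dots> = 2 * cnj (fst (\<delta> t)) * (\<beta>' t - \<alpha>' t * fst (\<delta> t))"
      unfolding null by (simp add: algebra_simps)
    finally show ?thesis unfolding W'_def Z'_def by simp
  qed
  have speed: "cmod (Z' t) = cmod (z' t) / cmod (\<alpha> t)" for t
  proof -
    \<comment> \<open>The derivative of the lift is \<alpha> (0, Z', W') + \<alpha>' (1, Z, W). The
      second vector is null and orthogonal to the first, so only |\<alpha> Z'|^2 survives in the
      form.\<close>
    have b: "\<beta>' t = \<alpha> t * Z' t + \<alpha>' t * fst (\<delta> t)" and c: "\<kappa>' t = \<alpha> t * W' t + \<alpha>' t * wcoord (\<delta> t)"
      using nz[of t] by (simp_all add: Z'_def W'_def)
    have w: "cnj (wcoord (\<delta> t)) = 2 * fst (\<delta> t) * cnj (fst (\<delta> t)) - wcoord (\<delta> t)"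
      using null[of t] by (simp add: algebra_simps)
    have "- 2 * (cnj (z' t) * z' t) = herm 0 (z' t) (w' t) 0 (z' t) (w' t)" by (simp add: herm_def)
    also have "\<dots> = herm (\<alpha>' t) (\<beta>' t) (\<kappa>' t) (\<alpha>' t) (\<beta>' t) (\<kappa>' t)"
      unfolding \<alpha>'_def \<beta>'_def \<kappa>'_def iso ..
    also have "\<dots> = - 2 * (cnj (\<alpha> t * Z' t) * (\<alpha> t * Z' t))"
      unfolding herm_def b c leg by (simp add: w algebra_simps)
    finally have "cnj (z' t) * z' t = cnj (\<alpha> t * Z' t) * (\<alpha> t * Z' t)" by simp
    then have "complex_of_real ((cmod (z' t))^2) = of_real ((cmod (\<alpha> t * Z' t))^2)"
      by (simp only: complex_norm_square mult.commute)
    then have "cmod (z' t) = cmod (\<alpha> t) * cmod (Z' t)"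
      by (simp only: of_real_eq_iff norm_mult) (simp add: power2_eq_iff_nonneg)
    then show ?thesis using nz[of t] by simp
  qed
  have L: "0 < L" and per: "\<And>t. \<gamma> (t + L) = \<gamma> t" and inj: "inj_on \<gamma> {0..<L}"
    using K by (auto simp: legendrian_knot_def)
  have per': "\<delta> (t + L) = \<delta> t" for t by (simp add: \<delta>_def image_curve_def per)
  have inj': "inj_on \<delta> {0..<L}"
  proof (rule inj_onI)
    fix s t assume st: "s \<in> {0..<L}" "t \<in> {0..<L}" "\<delta> s = \<delta> t"
    \<comment> \<open>Coinciding image points make \<open>polar\<close> vanish for the original
      points as well, and these then coincide.\<close>
    have "koranyi_dist (\<delta> s) (\<delta> t) = 0" using st(3) by (simp add: koranyi_dist_eq_0_iff)
    then have "koranyi_dist (\<gamma> s) (\<gamma> t) = 0" by (simp add: koranyi_dist_eq polar)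
    then show "s = t" using st inj by (auto simp: koranyi_dist_eq_0_iff dest: inj_onD)
  qed
  have smooth': "csmooth (\<lambda>t. fst (\<delta> t))" "csmooth (\<lambda>t. wcoord (\<delta> t))"
    unfolding Z_eq W_eq by (intro csmooth_divide smooth nz)+
  have nz': "Z' t \<noteq> 0" for t using speed[of t] z'(5)[of t] nz[of t] by auto
  note image = legendrian_knotI[OF L per' inj' smooth' der_Z der_W[unfolded leg] nz']
  show ?thesis
    by (rule that[of \<alpha>]) (use image nz polar speed z'(6) in \<open>simp_all add: \<delta>_def\<close>)
qed

section \<open>Invariance of the energy\<close>

text \<open>The complement of the exceptional set is connected and contains Re \<zeta> > -1, so by
  the identity theorem any continuation computes the value selected by the definite
  description.\<close>

lemma energy_eqI:
  assumes f: "f holomorphic_on (- odd_neg_ints)" "\<And>\<zeta>. - 1 < Re \<zeta> \<Longrightarrow> f \<zeta> = beta_fun \<gamma> L \<zeta>"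
  shows "energy \<gamma> L = f (- 2)"
  unfolding energy_def
proof (rule the_equality)
  show "\<exists>g. g holomorphic_on (- odd_neg_ints) \<and> (\<forall>\<zeta>. Re \<zeta> > - 1 \<longrightarrow> g \<zeta> = beta_fun \<gamma> L \<zeta>) \<and> f (- 2) = g (- 2)"
    using f by blast
  fix e assume "\<exists>g. g holomorphic_on (- odd_neg_ints) \<and> (\<forall>\<zeta>. Re \<zeta> > - 1 \<longrightarrow> g \<zeta> = beta_fun \<gamma> L \<zeta>) \<and> e = g (- 2)"
  then obtain g where g: "g holomorphic_on (- odd_neg_ints)" "\<And>\<zeta>. - 1 < Re \<zeta> \<Longrightarrow> g \<zeta> = beta_fun \<gamma> L \<zeta>" "e = g (- 2)"
    by blast
  have "g (- 2) = f (- 2)"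
  proof (rule analytic_continuation_open[where s="{\<zeta>. - 1 < Re \<zeta>}" and s'="- odd_neg_ints" and f=g and g=f])
    show "open {\<zeta>. - 1 < Re \<zeta>}" by (rule open_halfspace_Re_gt)
    show "{\<zeta>. - 1 < Re \<zeta>} \<noteq> {}" by (auto intro: exI[of _ 0])
    show "connected (- odd_neg_ints :: complex set)"
      unfolding Compl_eq_Diff_UNIV
      by (intro connected_open_diff_countable countable_odd_neg_ints) auto
    show "{\<zeta>. - 1 < Re \<zeta>} \<subseteq> - odd_neg_ints" by (auto simp: odd_neg_ints_def)
  qed (use f g open_Compl_odd_neg_ints odd_neg_ints_not_minus_2 in auto)
  then show "e = f (- 2)" by (simp add: g(3))
qed

lemma beta_fun_eq_mellin:
  assumes K: "legendrian_knot \<gamma> L" and g: "smooth_kernel L g"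
    and k_eq: "\<And>\<zeta> s r. 0 < \<bar>r\<bar> \<Longrightarrow> \<bar>r\<bar> < L \<Longrightarrow>
      of_real (koranyi_dist (\<gamma> s) (\<gamma> (s + r))) powr \<zeta> * of_real (hspeed \<gamma> s * hspeed \<gamma> (s + r)) =
      of_real \<bar>r\<bar> powr \<zeta> * g \<zeta> s r"
    and re: "- 1 < Re \<zeta>"
  shows "beta_fun \<gamma> L \<zeta> = mellin L (L/2) 0 (\<lambda>\<zeta> s r. g \<zeta> s r + g \<zeta> s (- r)) \<zeta>"
  unfolding beta_fun_def
proof (rule double_integral_eq_mellin[OF _ _ _ order_refl re g])
  obtain z' where z': "csmooth (\<lambda>t. fst (\<gamma> t))" "csmooth (\<lambda>t. wcoord (\<gamma> t))" "csmooth z'"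
    "\<And>t. hspeed \<gamma> t = cmod (z' t)"
    by (rule legendrian_knotD[OF K]) blast
  note cont = z'(1-3)[THEN csmooth_continuous, of UNIV, THEN continuous_on_compose2]
  have "continuous_on UNIV (\<lambda>p. complex_of_real (koranyi_dist (\<gamma> (fst p)) (\<gamma> (snd p))))"
    unfolding koranyi_dist_eq polar_def
    by (intro continuous_intros cont(1)[of _ fst] cont(1)[of _ snd] cont(2)[of _ fst] cont(2)[of _ snd]) auto
  then have [measurable]: "(\<lambda>p. complex_of_real (koranyi_dist (\<gamma> (fst p)) (\<gamma> (snd p)))) \<in> borel_measurable borel"
    by (rule borel_measurable_continuous_onI)
  have "continuous_on UNIV (\<lambda>p. complex_of_real (hspeed \<gamma> (fst p) * hspeed \<gamma> (snd p)))"
    unfolding z'(4) by (intro continuous_intros cont(3)[of _ fst] cont(3)[of _ snd]) auto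
  then have [measurable]: "(\<lambda>p. complex_of_real (hspeed \<gamma> (fst p) * hspeed \<gamma> (snd p))) \<in> borel_measurable borel"
    by (rule borel_measurable_continuous_onI)
  \<comment> \<open>The power need not be continuous on the diagonal, where the distance is 0, but
    it is Borel as a composition with the Borel function \<open>powr\<close>.\<close>
  show "(\<lambda>p. complex_of_real (koranyi_dist (\<gamma> (fst p)) (\<gamma> (snd p))) powr \<zeta> *
      complex_of_real (hspeed \<gamma> (fst p) * hspeed \<gamma> (snd p))) \<in> borel_measurable borel"
    by measurable
  have "\<gamma> (t + L) = \<gamma> t" for t using K by (auto simp: legendrian_knot_def)
  moreover from this have "hspeed \<gamma> (t + L) = hspeed \<gamma> t" for t
  proof -
    have "(\<lambda>r. \<gamma> (L + r)) = \<gamma>" using \<open>\<And>t. \<gamma> (t + L) = \<gamma> t\<close> by (simp add: add.commute)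
    then have "(\<gamma> has_vector_derivative D) (at (t + L)) \<longleftrightarrow> (\<gamma> has_vector_derivative D) (at t)" for D
      using has_vector_derivative_translate[of \<gamma> L D t] by (simp add: add.commute)
    then show ?thesis by (simp add: hspeed_def vector_derivative_def)
  qed
  ultimately show "complex_of_real (koranyi_dist (\<gamma> s) (\<gamma> (t + L))) powr \<zeta> *
      complex_of_real (hspeed \<gamma> s * hspeed \<gamma> (t + L)) =
      complex_of_real (koranyi_dist (\<gamma> s) (\<gamma> t)) powr \<zeta> * complex_of_real (hspeed \<gamma> s * hspeed \<gamma> t)" for s t
    by simp
  show "0 < L" using K by (simp add: legendrian_knot_def)
qed (rule k_eq)

lemma even_kernel_symmetrize: "smooth_kernel b g \<Longrightarrow> even_kernel b (\<lambda>\<zeta> s r. g \<zeta> s r + g \<zeta> s (- r))"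
  unfolding even_kernel_def by (auto intro: smooth_kernel.add smooth_kernel.reflect)

lemma koranyi_dist_nonneg: "0 \<le> koranyi_dist p q"
  by (simp add: koranyi_dist_eq)

text \<open>At d = 0 both sides are 0 by convention.\<close>

lemma of_real_powr_minus_2: "0 \<le> d \<Longrightarrow> complex_of_real d powr - 2 = of_real (inverse (d^2))"
  by (cases "d = 0") (simp_all add: powr_minus powr_of_real[symmetric])

theorem theorem3p1:
  fixes \<gamma> :: "real \<Rightarrow> heis" and L :: real and T :: "heis option \<Rightarrow> heis option"
  assumes "legendrian_knot \<gamma> L"
    and "T \<in> PU21"
    and "\<forall>t. T (Some (\<gamma> t)) \<noteq> None"
  shows "energy \<gamma> L = energy (image_curve T \<gamma>) L"
proof -
  define \<delta> where "\<delta> = image_curve T \<gamma>"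
  obtain \<alpha> where \<delta>: "legendrian_knot \<delta> L" and \<alpha>: "\<And>t. \<alpha> t \<noteq> 0"
    and speed: "\<And>t. hspeed \<delta> t = hspeed \<gamma> t / cmod (\<alpha> t)"
    and polar: "\<And>s t. polar (\<gamma> s) (\<gamma> t) = cnj (\<alpha> s) * \<alpha> t * polar (\<delta> s) (\<delta> t)"
    unfolding \<delta>_def by (rule legendrian_knot_image[OF assms(1,2)]) (use assms(3) in blast)+
  have L: "0 < L" using assms(1) by (simp add: legendrian_knot_def)
  obtain g where g: "smooth_kernel L g" "\<And>\<zeta> s r. 0 < \<bar>r\<bar> \<Longrightarrow> \<bar>r\<bar> < L \<Longrightarrow>
      of_real (koranyi_dist (\<gamma> s) (\<gamma> (s + r))) powr \<zeta> * of_real (hspeed \<gamma> s * hspeed \<gamma> (s + r)) =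
      of_real \<bar>r\<bar> powr \<zeta> * g \<zeta> s r"
    by (rule legendrian_knot_kernel[OF assms(1)]) blast
  obtain h where h: "smooth_kernel L h" "\<And>\<zeta> s r. 0 < \<bar>r\<bar> \<Longrightarrow> \<bar>r\<bar> < L \<Longrightarrow>
      of_real (koranyi_dist (\<delta> s) (\<delta> (s + r))) powr \<zeta> * of_real (hspeed \<delta> s * hspeed \<delta> (s + r)) =
      of_real \<bar>r\<bar> powr \<zeta> * h \<zeta> s r"
    by (rule legendrian_knot_kernel[OF \<delta>]) blast
  define G where "G = (\<lambda>\<zeta> s r. g \<zeta> s r + g \<zeta> s (- r))"
  \<comment> \<open>The symmetrised difference of the two kernels, whose Mellin integral is the
    difference of the two beta functions. Subtraction makes sense because the image curve keeps the
    parameter t.\<close>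
  define D where "D = (\<lambda>\<zeta> s r. (h \<zeta> s r - g \<zeta> s r) + (h \<zeta> s (- r) - g \<zeta> s (- r)))"
  have G: "even_kernel L G" unfolding G_def by (rule even_kernel_symmetrize[OF g(1)])
  have D: "even_kernel L D" unfolding D_def
    by (rule even_kernel_symmetrize[OF smooth_kernel_diff[OF h(1) g(1)]])
  have invariant: "g (- 2) s r = h (- 2) s r" if r: "0 < \<bar>r\<bar>" "\<bar>r\<bar> < L" for s r
  proof -
    \<comment> \<open>The squared distance and the product of the speeds are both divided by
      |\<alpha>(s) \<alpha>(t)|, so their quotient is unchanged.\<close>
    have "inverse ((koranyi_dist (\<delta> s) (\<delta> t))^2) * (hspeed \<delta> s * hspeed \<delta> t) =
        inverse ((koranyi_dist (\<gamma> s) (\<gamma> t))^2) * (hspeed \<gamma> s * hspeed \<gamma> t)" for t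
      using \<alpha>[of s] \<alpha>[of t] by (simp add: koranyi_dist_eq polar speed norm_mult field_simps)
    from arg_cong[OF this[of "s + r"], of complex_of_real]
    have "complex_of_real (koranyi_dist (\<delta> s) (\<delta> (s + r))) powr - 2 * of_real (hspeed \<delta> s * hspeed \<delta> (s + r)) =
        of_real (koranyi_dist (\<gamma> s) (\<gamma> (s + r))) powr - 2 * of_real (hspeed \<gamma> s * hspeed \<gamma> (s + r))"
      by (simp only: of_real_powr_minus_2[OF koranyi_dist_nonneg] of_real_mult)
    then have "complex_of_real \<bar>r\<bar> powr - 2 * g (- 2) s r = of_real \<bar>r\<bar> powr - 2 * h (- 2) s r"
      unfolding g(2)[OF r] h(2)[OF r] by (rule sym)
    moreover have "complex_of_real \<bar>r\<bar> powr - 2 \<noteq> 0" using r by simp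
    ultimately show ?thesis by (metis mult_left_cancel)
  qed
  obtain f where f: "f holomorphic_on (- odd_neg_ints)" "\<And>\<zeta>. - 1 < Re \<zeta> \<Longrightarrow> f \<zeta> = mellin L (L/2) 0 G \<zeta>"
    by (rule mellin_continuation[OF G, of "L/2"]) (use L in auto)
  obtain d where d: "d holomorphic_on (- odd_neg_ints)" "\<And>\<zeta>. - 1 < Re \<zeta> \<Longrightarrow> d \<zeta> = mellin L (L/2) 0 D \<zeta>"
    "\<And>\<zeta>. \<zeta> \<notin> odd_neg_ints \<Longrightarrow> (\<And>s r. r \<in> {0<..<L} \<Longrightarrow> D \<zeta> s r = 0) \<Longrightarrow> d \<zeta> = 0"
    by (rule mellin_continuation[OF D, of "L/2"]) (use L in auto)
  have "energy \<gamma> L = f (- 2)"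
    by (rule energy_eqI[OF f(1)]) (simp add: f(2) beta_fun_eq_mellin[OF assms(1) g] G_def)
  \<comment> \<open>The sum of the two continuations agrees with the beta function of the image on
    the half-plane of convergence, hence also gives its energy.\<close>
  moreover have "energy \<delta> L = f (- 2) + d (- 2)"
  proof (rule energy_eqI)
    show "(\<lambda>\<zeta>. f \<zeta> + d \<zeta>) holomorphic_on (- odd_neg_ints)" by (intro holomorphic_intros f d)
    fix \<zeta> :: complex assume re: "- 1 < Re \<zeta>"
    have "beta_fun \<delta> L \<zeta> = mellin L (L/2) 0 (\<lambda>\<zeta> s r. G \<zeta> s r + D \<zeta> s r) \<zeta>"
      by (simp add: beta_fun_eq_mellin[OF \<delta> h] re G_def D_def)
    also have "\<dots> = f \<zeta> + d \<zeta>"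
      using mellin_add[OF G D, of "L/2" \<zeta> L] L re by (simp add: f(2) d(2))
    finally show "f \<zeta> + d \<zeta> = beta_fun \<delta> L \<zeta>" ..
  qed
  \<comment> \<open>Vanishing of D(-2) for 0 < r < L is all that the continuation property asks; the
    diagonal r = 0, where the factorisations say nothing, is excluded there.\<close>
  moreover have "d (- 2) = 0"
    by (rule d(3)[OF odd_neg_ints_not_minus_2]) (simp add: D_def invariant)
  ultimately show ?thesis by (simp add: \<delta>_def)
qed

end
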